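(* The vertex-Turán density of $Q_6$ is greater than $6/7$. Equivalently, $\gamma_6 < 1/7$.
   Context: Let $Q_n$ denote the $n$-dimensional discrete cube with vertex set $\{0,1\}^n$, two vectors being adjacent if they differ in exactly one coordinate. A copy of $Q_d$ in $Q_n$ is the vertex set of a $d$-dimensional subcube, i.e. a set of the form $\{x \in \{0,1\}^n : x_i = a_i \text{ for all } i \notin I\}$ for some $I \subset [n]$ with $|I| = d$ and some fixed values $a_i \in \{0,1\}$. Let $\mathrm{exc}(n,Q_d)$ be the maximum size of a subset of $\{0,1\}^n$ containing no copy of $Q_d$, and define the vertex-Turán density $\lambda(Q_d) = \lim_{n\to\infty} \mathrm{exc}(n,Q_d)/2^n$ (this limit exists). Let $g(n,d)$ be the minimum size of a subset of $\{0,1\}^n$ that intersects every copy of $Q_d$, and $\gamma_d = \lim_{n\to\infty} g(n,d)/2^n$, so that $\gamma_d = 1 - \lambda(Q_d)$. *)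

theory Defs
  imports Complex_Main "HOL-Library.FuncSet"
begin

definition cube :: "nat \<Rightarrow> (nat \<Rightarrow> nat) set" where
  "cube n = {1..n} \<rightarrow>\<^sub>E {0, 1}"

definition subcubes :: "nat \<Rightarrow> nat \<Rightarrow> (nat \<Rightarrow> nat) set set" where
  "subcubes n d =
     {{x \<in> cube n. \<forall>i\<in>{1..n} - I. x i = a i} | I a.
        I \<subseteq> {1..n} \<and> card I = d \<and> a \<in> {1..n} - I \<rightarrow> {0, 1}}"

definition exc :: "nat \<Rightarrow> nat \<Rightarrow> nat" where
  "exc n d = Max {card A | A. A \<subseteq> cube n \<and> (\<forall>C\<in>subcubes n d. \<not> C \<subseteq> A)}"

definition hitting_number :: "nat \<Rightarrow> nat \<Rightarrow> nat" where
  "hitting_number n d =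
     Min {card A | A. A \<subseteq> cube n \<and> (\<forall>C\<in>subcubes n d. A \<inter> C \<noteq> {})}"

definition vertex_turan_density :: "nat \<Rightarrow> real" where
  "vertex_turan_density d = lim (\<lambda>n. real (exc n d) / 2 ^ n)"

definition hitting_density :: "nat \<Rightarrow> real" where
  "hitting_density d = lim (\<lambda>n. real (hitting_number n d) / 2 ^ n)"

text \<open>
  Since \<^const>\<open>lim\<close> is unspecified on divergent sequences, the following facts show that
  both densities are genuine limits.
\<close>

lemma finite_cube: "finite (cube n)"
  by (simp add: cube_def finite_PiE)

lemma card_cube: "card (cube n) = 2 ^ n"
  by (simp add: cube_def card_PiE numeral_2_eq_2)

lemma subcubes_subset: "C \<in> subcubes n d \<Longrightarrow> C \<subseteq> cube n"
  by (auto simp: subcubes_def)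

lemma subcubes_nonempty:
  assumes "C \<in> subcubes n d" shows "C \<noteq> {}"
proof -
  obtain I a where C: "C = {x \<in> cube n. \<forall>i\<in>{1..n} - I. x i = a i}"
    and a: "a \<in> {1..n} - I \<rightarrow> {0, 1}"
    using assms by (auto simp: subcubes_def)
  have "(\<lambda>i. if i \<in> {1..n} then if i \<in> I then 0 else a i else undefined) \<in> C"
    using a unfolding C cube_def by (auto simp: PiE_iff extensional_def Pi_iff)
  then show ?thesis by blast
qed

lemma finite_card_subsets: "finite {card A | A. A \<subseteq> cube n \<and> P A}"
proof (rule finite_subset)
  show "{card A | A. A \<subseteq> cube n \<and> P A} \<subseteq> card ` Pow (cube n)" by auto
qed (simp add: finite_cube)

lemma exc_upper:
  assumes "A \<subseteq> cube n" "\<forall>C\<in>subcubes n d. \<not> C \<subseteq> A"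
  shows "card A \<le> exc n d"
  unfolding exc_def using assms by (intro Max_ge finite_card_subsets) blast

lemma exc_attained:
  obtains A where "A \<subseteq> cube n" "\<forall>C\<in>subcubes n d. \<not> C \<subseteq> A" "card A = exc n d"
proof -
  have "{} \<subseteq> cube n \<and> (\<forall>C\<in>subcubes n d. \<not> C \<subseteq> {})"
    using subcubes_nonempty by auto
  then have "exc n d \<in> {card A | A. A \<subseteq> cube n \<and> (\<forall>C\<in>subcubes n d. \<not> C \<subseteq> A)}"
    unfolding exc_def by (intro Max_in finite_card_subsets) blast
  then show ?thesis using that by auto
qed

lemma hitting_number_lower:
  assumes "A \<subseteq> cube n" "\<forall>C\<in>subcubes n d. A \<inter> C \<noteq> {}"
  shows "hitting_number n d \<le> card A"
  unfolding hitting_number_def using assms by (intro Min_le finite_card_subsets) blast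

lemma hitting_number_attained:
  obtains A where "A \<subseteq> cube n" "\<forall>C\<in>subcubes n d. A \<inter> C \<noteq> {}"
    "card A = hitting_number n d"
proof -
  have "cube n \<subseteq> cube n \<and> (\<forall>C\<in>subcubes n d. cube n \<inter> C \<noteq> {})"
    using subcubes_nonempty[of _ n d] subcubes_subset[of _ n d] by (simp add: Int_absorb1)
  then have "hitting_number n d \<in> {card A | A. A \<subseteq> cube n \<and> (\<forall>C\<in>subcubes n d. A \<inter> C \<noteq> {})}"
    unfolding hitting_number_def by (intro Min_in finite_card_subsets) blast
  then show ?thesis using that by auto
qed

lemma exc_add_hitting_number: "exc n d + hitting_number n d = 2 ^ n"
proof (rule antisym)
  obtain A where A: "A \<subseteq> cube n" "\<forall>C\<in>subcubes n d. \<not> C \<subseteq> A" "card A = exc n d"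
    by (rule exc_attained)
  have "\<forall>C\<in>subcubes n d. (cube n - A) \<inter> C \<noteq> {}"
  proof
    fix C assume C: "C \<in> subcubes n d"
    with A(2) have "\<not> C \<subseteq> A" by (rule bspec)
    then show "(cube n - A) \<inter> C \<noteq> {}" using subcubes_subset[OF C] by auto
  qed
  then have "hitting_number n d \<le> card (cube n - A)"
    by (intro hitting_number_lower) auto
  also have "\<dots> = 2 ^ n - exc n d"
    using A finite_subset[OF A(1) finite_cube] by (simp add: card_Diff_subset card_cube)
  finally show "exc n d + hitting_number n d \<le> 2 ^ n"
    using card_mono[OF finite_cube A(1)] A(3) by (simp add: card_cube)
  obtain B where B: "B \<subseteq> cube n" "\<forall>C\<in>subcubes n d. B \<inter> C \<noteq> {}"
    "card B = hitting_number n d"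
    by (rule hitting_number_attained)
  have "card (cube n - B) \<le> exc n d"
  proof (rule exc_upper)
    show "\<forall>C\<in>subcubes n d. \<not> C \<subseteq> cube n - B"
    proof
      fix C assume "C \<in> subcubes n d"
      with B(2) have "B \<inter> C \<noteq> {}" by (rule bspec)
      then show "\<not> C \<subseteq> cube n - B" by auto
    qed
  qed simp
  moreover have "card (cube n - B) = 2 ^ n - hitting_number n d"
    using B finite_subset[OF B(1) finite_cube] by (simp add: card_Diff_subset card_cube)
  ultimately show "2 ^ n \<le> exc n d + hitting_number n d" by simp
qed

lemma exc_Suc: "exc (Suc n) d \<le> 2 * exc n d"
proof -
  obtain A where A: "A \<subseteq> cube (Suc n)" "\<forall>C\<in>subcubes (Suc n) d. \<not> C \<subseteq> A"
    "card A = exc (Suc n) d"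
    by (rule exc_attained)
  define B where "B b = {y \<in> cube n. y(Suc n := b) \<in> A}" for b
  have B: "card (B b) \<le> exc n d" if b: "b \<in> {0, 1}" for b
  proof (rule exc_upper)
    show "B b \<subseteq> cube n" by (auto simp: B_def)
    show "\<forall>C\<in>subcubes n d. \<not> C \<subseteq> B b"
    proof (intro ballI notI)
      fix C assume C: "C \<in> subcubes n d" "C \<subseteq> B b"
      obtain I a where Ia: "C = {x \<in> cube n. \<forall>i\<in>{1..n} - I. x i = a i}"
        "I \<subseteq> {1..n}" "card I = d" "a \<in> {1..n} - I \<rightarrow> {0, 1}"
        using C(1) by (auto simp: subcubes_def)
      define a' where "a' = a(Suc n := b)"
      define C' where "C' = {x \<in> cube (Suc n). \<forall>i\<in>{1..Suc n} - I. x i = a' i}"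
      have "I \<subseteq> {1..Suc n}" "a' \<in> {1..Suc n} - I \<rightarrow> {0, 1}"
        using Ia b by (auto simp: a'_def Pi_iff)
      then have "C' \<in> subcubes (Suc n) d"
        using Ia(3) unfolding subcubes_def C'_def by blast
      moreover have "C' \<subseteq> A"
      proof
        fix x assume x: "x \<in> C'"
        have "Suc n \<notin> I" using Ia(2) by auto
        then have xb: "x (Suc n) = b"
          using x \<open>Suc n \<notin> I\<close> by (simp add: C'_def a'_def)
        have "x(Suc n := undefined) \<in> cube n"
          using x by (auto simp: C'_def cube_def PiE_iff extensional_def)
        moreover have "\<forall>i\<in>{1..n} - I. x i = a i"
          using x by (auto simp: C'_def a'_def)
        ultimately have "x(Suc n := undefined) \<in> C"
          by (auto simp: Ia(1))
        then have "x(Suc n := undefined, Suc n := b) \<in> A"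
          using C(2) unfolding B_def by blast
        then show "x \<in> A" using xb by (simp add: fun_upd_idem)
      qed
      ultimately show False using A(2) by blast
    qed
  qed
  have "A \<subseteq> (\<lambda>y. y(Suc n := 0)) ` B 0 \<union> (\<lambda>y. y(Suc n := 1)) ` B 1"
  proof
    fix x assume x: "x \<in> A"
    then have xc: "x \<in> cube (Suc n)" using A(1) by blast
    then have y: "x(Suc n := undefined) \<in> cube n"
      by (auto simp: cube_def PiE_iff extensional_def)
    have "x (Suc n) = 0 \<or> x (Suc n) = 1"
      using xc by (auto simp: cube_def PiE_iff)
    moreover have "x \<in> (\<lambda>y. y(Suc n := b)) ` B b" if "x (Suc n) = b" for b
    proof (rule image_eqI)
      show eq: "x = (x(Suc n := undefined))(Suc n := b)"
        by (simp only: fun_upd_upd that[symmetric] fun_upd_triv)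
      show "x(Suc n := undefined) \<in> B b"
        unfolding B_def mem_Collect_eq eq[symmetric] using x y by (rule conjI[rotated])
    qed
    ultimately show "x \<in> (\<lambda>y. y(Suc n := 0)) ` B 0 \<union> (\<lambda>y. y(Suc n := 1)) ` B 1"
      by (metis UnI1 UnI2)
  qed
  moreover have fin: "finite (B b)" for b
    using finite_cube by (simp add: B_def)
  ultimately have "card A \<le> card ((\<lambda>y. y(Suc n := 0)) ` B 0 \<union> (\<lambda>y. y(Suc n := 1)) ` B 1)"
    by (intro card_mono) auto
  also have "\<dots> \<le> card (B 0) + card (B 1)"
    by (rule order_trans[OF card_Un_le add_mono]) (auto intro: card_image_le fin)
  also have "\<dots> \<le> 2 * exc n d" using B[of 0] B[of 1] by simp
  finally show ?thesis by (simp add: A(3))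
qed

lemma vertex_turan_density_tendsto:
  "(\<lambda>n. real (exc n d) / 2 ^ n) \<longlonglongrightarrow> vertex_turan_density d"
proof -
  have "decseq (\<lambda>n. real (exc n d) / 2 ^ n)"
  proof (rule decseq_SucI)
    fix n
    have "real (exc (Suc n) d) \<le> 2 * real (exc n d)"
      using exc_Suc[of n d] by linarith
    then show "real (exc (Suc n) d) / 2 ^ Suc n \<le> real (exc n d) / 2 ^ n"
      by (simp add: field_simps)
  qed
  then have "convergent (\<lambda>n. real (exc n d) / 2 ^ n)"
    by (rule decseq_convergent[where B = 0]) (auto simp: convergent_def)
  then show ?thesis
    by (simp add: vertex_turan_density_def convergent_LIMSEQ_iff)
qed

lemma hitting_density_tendsto:
    "(\<lambda>n. real (hitting_number n d) / 2 ^ n) \<longlonglongrightarrow> hitting_density d"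
  and hitting_density_eq: "hitting_density d = 1 - vertex_turan_density d"
proof -
  have "real (hitting_number n d) / 2 ^ n = 1 - real (exc n d) / 2 ^ n" for n
  proof -
    have "real (exc n d) + real (hitting_number n d) = 2 ^ n"
      using exc_add_hitting_number[of n d]
      by (metis of_nat_add of_nat_numeral of_nat_power)
    then show ?thesis by (simp add: field_simps)
  qed
  then have *: "(\<lambda>n. real (hitting_number n d) / 2 ^ n) \<longlonglongrightarrow> 1 - vertex_turan_density d"
    by (simp add: tendsto_diff vertex_turan_density_tendsto)
  then show "hitting_density d = 1 - vertex_turan_density d"
    unfolding hitting_density_def by (rule limI)
  with * show "(\<lambda>n. real (hitting_number n d) / 2 ^ n) \<longlonglongrightarrow> hitting_density d"
    by simp
qed

end

theory Submission
  imports Defs "HOL-Library.Function_Algebras" "HOL-Library.Product_Plus"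
begin

text \<open>
  Let \<open>V = F\<^sub>3\<^sup>r\<close> and label every coordinate \<open>i\<close> by a random pair \<open>(m\<^sub>i, n\<^sub>i) \<in> V \<times> V\<close>, read as the
  vector \<open>m\<^sub>i + t n\<^sub>i\<close> over \<open>F\<^sub>3[[t]]\<close>. Call an \<open>r\<close>-set \<open>S\<close> good if the lattice spanned by its labels is the
  preimage of a subspace \<open>U\<close> of \<open>V\<close> of codimension 0 or 2. The hitting set consists of the bad
  \<open>r\<close>-sets with \<open>r\<close> in a fixed residue class modulo 3.

  A copy of \<open>Q\<^sub>6\<close> with bottom \<open>R\<close> and directions \<open>X\<close> meets one of these layers in all sets \<open>R \<union> Y\<close>,
  \<open>Y \<subseteq> X\<close>, \<open>|Y| = s\<close>, for some \<open>s \<in> {2, 3, 4}\<close>. If all of them were good, then the codimension of the span of the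
  \<open>m\<^sub>i\<close>, which changes by at most one when one element is exchanged, would be constant. So the
  determinants of all \<open>R \<union> Y\<close> have the same valuation, and dividing it out represents the uniform matroid
  \<open>U\<^sub>s\<^sub>,\<^sub>6\<close> over \<open>F\<^sub>3\<close>, which is impossible.

  A set is good with probability at least \<open>\<Prod>\<^sub>k (1 - 3\<^sup>-\<^sup>k) (1 + (1 - 3\<^sup>-\<^sup>r) (1 - 3\<^sup>1\<^sup>-\<^sup>r) / 48) > 0.5715 > 4/7\<close>.
  The nonsingular matrices alone would only give \<open>0.5601 < 4/7\<close>; the sets of corank 2 close the gap.
\<close>

section \<open>Groups of exponent 3 as vector spaces over the field with three elements\<close>

class exponent3 = ab_group_add +
  assumes add_add_self: "x + x + x = 0"
begin

lemma uminus_eq_add_self: "- x = x + x"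
  using add_add_self[of x] by (metis add.commute add_eq_0_iff)

end

instance prod :: (exponent3, exponent3) exponent3
  by standard (auto simp: prod_eq_iff add_add_self)

instance "fun" :: (type, exponent3) exponent3
  by standard (auto simp: fun_eq_iff add_add_self)

datatype trit = Zero | One | Two

instantiation trit :: exponent3
begin

definition zero_trit :: trit where "zero_trit = Zero"

definition uminus_trit :: "trit \<Rightarrow> trit" where
  "uminus_trit x = (case x of Zero \<Rightarrow> Zero | One \<Rightarrow> Two | Two \<Rightarrow> One)"

definition plus_trit :: "trit \<Rightarrow> trit \<Rightarrow> trit" where
  "plus_trit x y = (case x of Zero \<Rightarrow> y
     | One \<Rightarrow> (case y of Zero \<Rightarrow> One | One \<Rightarrow> Two | Two \<Rightarrow> Zero)
     | Two \<Rightarrow> (case y of Zero \<Rightarrow> Two | One \<Rightarrow> Zero | Two \<Rightarrow> One))"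

definition minus_trit :: "trit \<Rightarrow> trit \<Rightarrow> trit" where
  "minus_trit x y = x + - (y :: trit)"

instance
  by standard
    (auto simp: zero_trit_def uminus_trit_def plus_trit_def minus_trit_def split: trit.splits)

end

lemma UNIV_trit: "(UNIV :: trit set) = {Zero, One, Two}"
  using trit.exhaust by auto

text \<open>In exponent 3, \<open>- x = x + x\<close>, so closure under addition already gives linear subspaces over \<open>F\<^sub>3\<close>.
  Dimensions are expressed through cardinalities throughout.\<close>

definition subsp :: "'a::exponent3 set \<Rightarrow> bool" where
  "subsp A \<longleftrightarrow> 0 \<in> A \<and> (\<forall>x\<in>A. \<forall>y\<in>A. x + y \<in> A)"

definition gen :: "'a::exponent3 set \<Rightarrow> 'a set" where
  "gen A = subsp hull A"

lemma subsp_0: "subsp A \<Longrightarrow> 0 \<in> A"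
  and subsp_add: "subsp A \<Longrightarrow> x \<in> A \<Longrightarrow> y \<in> A \<Longrightarrow> x + y \<in> A"
  by (auto simp: subsp_def)

lemma subsp_uminus: "subsp A \<Longrightarrow> x \<in> A \<Longrightarrow> - x \<in> A"
  by (simp add: uminus_eq_add_self subsp_add)

lemma subsp_diff: "subsp A \<Longrightarrow> x \<in> A \<Longrightarrow> y \<in> A \<Longrightarrow> x - y \<in> A"
  using subsp_add[of A x "- y"] subsp_uminus by auto

lemma subsp_add_iff: "subsp A \<Longrightarrow> x \<in> A \<Longrightarrow> x + y \<in> A \<longleftrightarrow> y \<in> A"
  using subsp_add[of A x y] subsp_diff[of A "x + y" x] by auto

lemma subsp_Inter: "(\<And>A. A \<in> F \<Longrightarrow> subsp A) \<Longrightarrow> subsp (\<Inter>F)"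
  by (auto simp: subsp_def)

lemma subsp_gen: "subsp (gen A)"
  unfolding gen_def hull_def by (rule subsp_Inter) auto

lemma gen_superset: "A \<subseteq> gen A"
  by (simp add: gen_def hull_subset)

lemma gen_base: "x \<in> A \<Longrightarrow> x \<in> gen A"
  using gen_superset by blast

lemma gen_minimal: "A \<subseteq> B \<Longrightarrow> subsp B \<Longrightarrow> gen A \<subseteq> B"
  by (simp add: gen_def hull_minimal)

lemma gen_mono: "A \<subseteq> B \<Longrightarrow> gen A \<subseteq> gen B"
  by (simp add: gen_def hull_mono)

lemma gen_subsp: "subsp A \<Longrightarrow> gen A = A"
  by (simp add: gen_minimal gen_superset subset_antisym)

lemma gen_eqI: "A \<subseteq> gen B \<Longrightarrow> B \<subseteq> gen A \<Longrightarrow> gen A = gen B"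
  by (simp add: gen_minimal subset_antisym subsp_gen)

lemma gen_gen_Un: "gen (gen A \<union> B) = gen (A \<union> B)"
proof (rule gen_eqI)
  show "gen A \<union> B \<subseteq> gen (A \<union> B)"
    using gen_mono[of A "A \<union> B"] gen_superset[of "A \<union> B"] by blast
  show "A \<union> B \<subseteq> gen (gen A \<union> B)"
    using gen_superset[of A] gen_superset[of "gen A \<union> B"] by blast
qed

lemma gen_insert_gen: "gen (insert x (gen A)) = gen (insert x A)"
  using gen_gen_Un[of A "{x}"] by (simp add: insert_is_Un[symmetric] Un_commute)

lemma gen_insert_redundant: "x \<in> gen A \<Longrightarrow> gen (insert x A) = gen A"
  by (rule gen_eqI) (auto intro: gen_base)

lemma gen_Un_subsp:
  assumes "subsp A" "subsp B"
  shows "gen (A \<union> B) = {a + b | a b. a \<in> A \<and> b \<in> B}" (is "_ = ?C")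
proof
  have "subsp ?C"
  proof (unfold subsp_def, intro conjI ballI)
    show "0 \<in> ?C" using subsp_0[OF assms(1)] subsp_0[OF assms(2)] by force
    fix x y assume "x \<in> ?C" "y \<in> ?C"
    then obtain a b a' b' where "x = a + b" "y = a' + b'" "a \<in> A" "b \<in> B" "a' \<in> A" "b' \<in> B" by blast
    then have "x + y = (a + a') + (b + b')" "a + a' \<in> A" "b + b' \<in> B"
      using assms by (auto simp: subsp_add algebra_simps)
    then show "x + y \<in> ?C" by blast
  qed
  moreover have "A \<union> B \<subseteq> ?C"
    using subsp_0[OF assms(1)] subsp_0[OF assms(2)] by force
  ultimately show "gen (A \<union> B) \<subseteq> ?C" by (rule gen_minimal[rotated])
  show "?C \<subseteq> gen (A \<union> B)" by (auto intro!: subsp_add[OF subsp_gen] intro: gen_base)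
qed

lemma gen_singleton: "gen {x} = {0, x, - x}"
proof
  have "x + x = - x" "- x + - x = x"
    by (metis uminus_eq_add_self minus_minus)+
  then have "subsp {0, x, - x}" by (simp add: subsp_def)
  then show "gen {x} \<subseteq> {0, x, - x}" by (simp add: gen_minimal)
  show "{0, x, - x} \<subseteq> gen {x}" 
    using subsp_0[OF subsp_gen] gen_base[of x "{x}"] subsp_uminus[OF subsp_gen] by auto
qed

lemma mem_gen_insert:
  assumes "subsp A"
  shows "y \<in> gen (insert x A) \<longleftrightarrow> y \<in> A \<or> y - x \<in> A \<or> y + x \<in> A"
proof -
  have "gen (insert x A) = gen (A \<union> gen {x})"
    using gen_gen_Un[of "{x}" A] by (simp add: Un_commute)
  also have "\<dots> = {a + b | a b. a \<in> A \<and> b \<in> {0, x, - x}}"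
    unfolding gen_singleton[symmetric] by (rule gen_Un_subsp[OF assms subsp_gen])
  finally have "gen (insert x A) = {a + b | a b. a \<in> A \<and> b \<in> {0, x, - x}}" .
  moreover have "y \<in> {a + b | a b. a \<in> A \<and> b \<in> {0, x, - x}} \<longleftrightarrow>
      (\<exists>a\<in>A. y = a) \<or> (\<exists>a\<in>A. y = a + x) \<or> (\<exists>a\<in>A. y = a - x)"
    by (force simp flip: diff_conv_add_uminus)
  moreover have "(\<exists>a\<in>A. y = a + x) \<longleftrightarrow> y - x \<in> A" "(\<exists>a\<in>A. y = a - x) \<longleftrightarrow> y + x \<in> A"
    by (metis add_diff_cancel diff_add_cancel)+
  ultimately show ?thesis by simp
qed

lemma gen_empty: "gen {} = {0}"
  using gen_minimal[of "{}" "{0}"] subsp_0[OF subsp_gen, of "{}"] by (auto simp: subsp_def[of "{0}"])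

lemma finite_gen:
  assumes "finite A" shows "finite (gen A)"
  using assms
proof (induction A)
  case empty
  then show ?case by (simp add: gen_empty)
next
  case (insert x A)
  have "gen (insert x A) \<subseteq> gen A \<union> (\<lambda>a. a + x) ` gen A \<union> (\<lambda>a. a - x) ` gen A"
  proof
    fix y assume "y \<in> gen (insert x A)"
    then have "y \<in> gen A \<or> y - x \<in> gen A \<or> y + x \<in> gen A"
      using mem_gen_insert[OF subsp_gen, of y x A] by (simp add: gen_insert_gen)
    then show "y \<in> gen A \<union> (\<lambda>a. a + x) ` gen A \<union> (\<lambda>a. a - x) ` gen A"
      using image_eqI[of y "\<lambda>a. a + x" "y - x" "gen A"]
        image_eqI[of y "\<lambda>a. a - x" "y + x" "gen A"] by auto
  qed
  then show ?case using insert.IH finite_subset by blast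
qed

lemma card_gen_insert:
  assumes "subsp A" "finite A" "x \<notin> A"
  shows "card (gen (insert x A)) = 3 * card A"
proof -
  have eq: "gen (insert x A) = A \<union> ((\<lambda>a. a + x) ` A \<union> (\<lambda>a. a - x) ` A)"
  proof -
    have "y \<in> (\<lambda>a. a + x) ` A \<longleftrightarrow> y - x \<in> A" "y \<in> (\<lambda>a. a - x) ` A \<longleftrightarrow> y + x \<in> A" for y
      using image_eqI[of y "\<lambda>a. a + x" "y - x" A]
        image_eqI[of y "\<lambda>a. a - x" "y + x" A] by auto
    then show ?thesis using mem_gen_insert[OF assms(1)] by blast
  qed
  have 1: "A \<inter> ((\<lambda>a. a + x) ` A \<union> (\<lambda>a. a - x) ` A) = {}"
  proof -
    have "a + x \<notin> A" "a - x \<notin> A" if "a \<in> A" for a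
      using that assms(3) subsp_add_iff[OF assms(1) that, of x]
        subsp_diff[OF assms(1) that, of "a - x"] by auto
    then show ?thesis by auto
  qed
  have 2: "(\<lambda>a. a + x) ` A \<inter> (\<lambda>a. a - x) ` A = {}"
  proof -
    have False if "a + x = b - x" "a \<in> A" "b \<in> A" for a b
    proof -
      have "b = a + (x + x)" using that(1) by (simp add: eq_diff_eq add.assoc)
      then have "x + x \<in> A" using that subsp_add_iff[OF assms(1) that(2), of "x + x"] by simp
      then have "- (x + x) \<in> A" by (rule subsp_uminus[OF assms(1)])
      then show False using assms(3) by (simp add: uminus_eq_add_self[symmetric])
    qed
    then show ?thesis by blast
  qed
  have "card (gen (insert x A)) = card A + (card ((\<lambda>a. a + x) ` A) + card ((\<lambda>a. a - x) ` A))"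
    unfolding eq using assms(2) 1 2 by (simp add: card_Un_disjoint)
  also have "\<dots> = 3 * card A" by (simp add: card_image inj_on_def)
  finally show ?thesis .
qed

lemma card_gen_insert_cases:
  assumes "finite A"
  shows "card (gen (insert x A)) = card (gen A) \<or> card (gen (insert x A)) = 3 * card (gen A)"
proof (cases "x \<in> gen A")
  case True
  then show ?thesis by (simp add: gen_insert_redundant)
next
  case False
  then show ?thesis
    using card_gen_insert[OF subsp_gen finite_gen[OF assms] False] by (simp add: gen_insert_gen)
qed

lemma card_gen_Un_image_le:
  assumes "finite A" "finite Y"
  shows "card (gen (A \<union> w ` Y)) \<le> 3 ^ card Y * card (gen A)"
  using assms(2)
proof (induction Y)
  case (insert y Y)
  have "card (gen (insert (w y) (A \<union> w ` Y))) \<le> 3 * card (gen (A \<union> w ` Y))"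
    using card_gen_insert_cases[of "A \<union> w ` Y" "w y"] assms(1) insert.hyps by auto
  then show ?case using insert by simp
qed simp

lemma gen_image:
  assumes add: "\<And>x y. f (x + y) = f x + f y"
  shows "f ` gen A = gen (f ` A)"
proof
  have 0: "f 0 = 0" using add[of 0 0] by simp
  have "subsp (f -` gen (f ` A))"
    using subsp_gen[of "f ` A"] by (auto simp: subsp_def add 0)
  then have "gen A \<subseteq> f -` gen (f ` A)" by (intro gen_minimal) (auto intro: gen_base)
  then show "f ` gen A \<subseteq> gen (f ` A)" by auto
  have "subsp (f ` gen A)" unfolding subsp_def
  proof (intro conjI ballI)
    show "0 \<in> f ` gen A" using 0 subsp_0[OF subsp_gen, of A] image_eqI by metis
    fix x y assume "x \<in> f ` gen A" "y \<in> f ` gen A"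
    then obtain a b where "x = f a" "y = f b" "a \<in> gen A" "b \<in> gen A" by blast
    then have "x + y = f (a + b)" "a + b \<in> gen A" using subsp_add[OF subsp_gen] by (auto simp: add)
    then show "x + y \<in> f ` gen A" by blast
  qed
  then show "gen (f ` A) \<subseteq> f ` gen A" by (intro gen_minimal) (auto intro: gen_base)
qed

lemma subsp_Times: "subsp A \<Longrightarrow> subsp B \<Longrightarrow> subsp (A \<times> B)"
  by (auto simp: subsp_def zero_prod_def)

section \<open>Uniform matroids that are not ternary\<close>

definition signed :: "bool \<Rightarrow> 'a::exponent3 \<Rightarrow> 'a" where
  "signed b x = (if b then x else - x)"

lemma mem_gen_insert_signed:
  assumes "subsp A" "y \<in> gen (insert x A)" "y \<notin> A"
  obtains b where "y - signed b x \<in> A"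
proof -
  have "y - x \<in> A \<or> y + x \<in> A" using assms mem_gen_insert by blast
  then show ?thesis using that[of True] that[of False] by (auto simp: signed_def)
qed

lemma signed_mem_gen_insert: "subsp A \<Longrightarrow> y - signed b x \<in> A \<Longrightarrow> y \<in> gen (insert x A)"
  by (simp add: mem_gen_insert signed_def split: if_splits)

lemma subsp_sum_diff:
  assumes "subsp P" "y - s \<in> P" "z - t \<in> P"
  shows "z - y - (t - s) \<in> P" "z + y - (t + s) \<in> P"
  using subsp_diff[OF assms(1,3,2)] subsp_add[OF assms(1,3,2)] by (simp_all add: algebra_simps)

lemma no_five_pairwise_spanning:
  fixes w :: "nat \<Rightarrow> 'a::exponent3"
  assumes P: "subsp P"
    and span: "\<And>i j. i < 5 \<Longrightarrow> j < 5 \<Longrightarrow> i \<noteq> j \<Longrightarrow> gen (P \<union> w ` {i, j}) = W"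
    and nospan: "\<And>x. gen (insert x P) \<noteq> W"
  shows False
proof -
  have no: "w j \<notin> gen (insert (w i) P)" if "i < 5" "j < 5" "i \<noteq> j" for i j
    using span[OF that] nospan[of "w i"] gen_insert_redundant[of "w j" "insert (w i) P"]
    by (auto simp: insert_commute)
  have ex: "\<exists>a b. w k - (signed a (w 0) + signed b (w 1)) \<in> P" if k: "2 \<le> k" "k < 5" for k
  proof -
    have "w k \<in> W" using span[of k 0] k by (auto intro: gen_base)
    then have "w k \<in> gen (insert (w 0) (gen (insert (w 1) P)))"
      using span[of 0 1] by (simp add: gen_insert_gen)
    moreover have "w k \<notin> gen (insert (w 1) P)" using no[of 1 k] k by simp
    ultimately obtain a where a: "w k - signed a (w 0) \<in> gen (insert (w 1) P)"
      by (rule mem_gen_insert_signed[OF subsp_gen])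
    have "w k - signed a (w 0) \<notin> P"
      using signed_mem_gen_insert[OF P] no[of 0 k] k by auto
    with a obtain b where "w k - signed a (w 0) - signed b (w 1) \<in> P"
      by (rule mem_gen_insert_signed[OF P])
    then show ?thesis by (metis diff_diff_eq)
  qed
  obtain a2 b2 where 2: "w 2 - (signed a2 (w 0) + signed b2 (w 1)) \<in> P" using ex[of 2] by auto
  obtain a3 b3 where 3: "w 3 - (signed a3 (w 0) + signed b3 (w 1)) \<in> P" using ex[of 3] by auto
  obtain a4 b4 where 4: "w 4 - (signed a4 (w 0) + signed b4 (w 1)) \<in> P" using ex[of 4] by auto
  have same: "w j \<in> gen (insert (w i) P)"
    if i: "w i - (signed a (w 0) + signed b (w 1)) \<in> P"
      and j: "w j - (signed c (w 0) + signed d (w 1)) \<in> P"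
      and eq: "(a = b) = (c = d)" for i j a b c d
  proof (cases "a = c")
    case True
    then have "b = d" using eq by auto
    then have "w j - w i \<in> P" using subsp_sum_diff(1)[OF P i j] True by simp
    then show ?thesis by (simp add: mem_gen_insert P)
  next
    case False
    then have "signed c (w 0) + signed d (w 1) + (signed a (w 0) + signed b (w 1)) = 0"
      using eq by (auto simp: signed_def)
    then have "w j + w i \<in> P" using subsp_sum_diff(2)[OF P i j] by simp
    then show ?thesis by (simp add: mem_gen_insert P)
  qed
  show False using same[OF 2 3] same[OF 2 4] same[OF 3 4] no[of 2 3] no[of 2 4] no[of 3 4]
    by (cases "a2 = b2"; cases "a3 = b3"; cases "a4 = b4") auto
qed

lemma no_five_triplewise_spanning:
  fixes w :: "nat \<Rightarrow> 'a::exponent3"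
  assumes P: "subsp P"
    and span: "\<And>i j k. i < 5 \<Longrightarrow> j < 5 \<Longrightarrow> k < 5 \<Longrightarrow> i \<noteq> j \<Longrightarrow> i \<noteq> k \<Longrightarrow> j \<noteq> k \<Longrightarrow>
      gen (P \<union> w ` {i, j, k}) = W"
    and nospan: "\<And>x y. gen (insert x (insert y P)) \<noteq> W"
  shows False
proof -
  have no: "w k \<notin> gen (insert (w i) (insert (w j) P))"
    if "i < 5" "j < 5" "k < 5" "i \<noteq> j" "i \<noteq> k" "j \<noteq> k" for i j k
    using span[OF that] nospan[of "w i" "w j"]
      gen_insert_redundant[of "w k" "insert (w i) (insert (w j) P)"]
    by (auto simp: insert_commute)
  have ex: "\<exists>a b c. w k - (signed a (w 0) + signed b (w 1) + signed c (w 2)) \<in> P"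
    if k: "3 \<le> k" "k < 5" for k
  proof -
    have "w k \<in> W" using span[of k 0 1] k by (auto intro: gen_base)
    then have "w k \<in> gen (insert (w 0) (gen (insert (w 1) (insert (w 2) P))))"
      using span[of 0 1 2] by (simp add: gen_insert_gen)
    moreover have "w k \<notin> gen (insert (w 1) (insert (w 2) P))" using no[of 1 2 k] k by simp
    ultimately obtain a where a: "w k - signed a (w 0) \<in> gen (insert (w 1) (insert (w 2) P))"
      by (rule mem_gen_insert_signed[OF subsp_gen])
    have "w k - signed a (w 0) \<notin> gen (insert (w 2) P)"
      using signed_mem_gen_insert[OF subsp_gen, of "w k" a "w 0" "insert (w 2) P"] no[of 0 2 k] k
      by (auto simp: gen_insert_gen)
    with a[folded gen_insert_gen[of "w 1" "insert (w 2) P"]]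
    obtain b where b: "w k - signed a (w 0) - signed b (w 1) \<in> gen (insert (w 2) P)"
      by (rule mem_gen_insert_signed[OF subsp_gen])
    have "w k - signed a (w 0) - signed b (w 1) \<notin> P"
    proof
      assume "w k - signed a (w 0) - signed b (w 1) \<in> P"
      then have "w k - signed a (w 0) \<in> gen (insert (w 1) P)"
        by (rule signed_mem_gen_insert[OF P])
      then have "w k \<in> gen (insert (w 0) (gen (insert (w 1) P)))"
        by (rule signed_mem_gen_insert[OF subsp_gen])
      then show False using no[of 0 1 k] k by (simp add: gen_insert_gen)
    qed
    with b obtain c where "w k - signed a (w 0) - signed b (w 1) - signed c (w 2) \<in> P"
      by (rule mem_gen_insert_signed[OF P])
    then show ?thesis by (metis diff_diff_eq)
  qed
  obtain a b c where 3: "w 3 - (signed a (w 0) + signed b (w 1) + signed c (w 2)) \<in> P"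
    using ex[of 3] by auto
  obtain a' b' c' where 4: "w 4 - (signed a' (w 0) + signed b' (w 1) + signed c' (w 2)) \<in> P"
    using ex[of 4] by auto
  have dbl: "x + x = - x" for x :: 'a by (simp only: uminus_eq_add_self)
  have key: "w 4 \<in> gen (insert (w 3) (insert (w i) P))"
    if "w 4 - w 3 - t \<in> P \<or> w 4 + w 3 - t \<in> P" "t \<in> {0, w i, - w i}" for t i
  proof -
    have sub: "P \<subseteq> gen (insert (w i) P)" "w i \<in> gen (insert (w i) P)"
      by (auto intro: gen_base)
    have t: "t \<in> gen (insert (w i) P)"
      using that(2) sub(2) subsp_0[OF subsp_gen] subsp_uminus[OF subsp_gen] by auto
    have "w 4 - w 3 \<in> gen (insert (w i) P) \<or> w 4 + w 3 \<in> gen (insert (w i) P)"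
      using that(1) sub(1) subsp_add[OF subsp_gen _ t] by (metis diff_add_cancel subsetD)
    then have "w 4 \<in> gen (insert (w 3) (gen (insert (w i) P)))"
      by (auto simp: mem_gen_insert subsp_gen)
    then show ?thesis by (simp add: gen_insert_gen)
  qed
  define t where "t = signed a' (w 0) + signed b' (w 1) + signed c' (w 2)
      - (signed a (w 0) + signed b (w 1) + signed c (w 2))"
  define t' where "t' = signed a' (w 0) + signed b' (w 1) + signed c' (w 2)
      + (signed a (w 0) + signed b (w 1) + signed c (w 2))"
  have tP: "w 4 - w 3 - t \<in> P" "w 4 + w 3 - t' \<in> P"
    using subsp_sum_diff[OF P 3 4] by (simp_all add: t_def t'_def)
  have "(t \<in> {0, w 0, - w 0} \<or> t' \<in> {0, w 0, - w 0}) \<or>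
      (t \<in> {0, w 1, - w 1} \<or> t' \<in> {0, w 1, - w 1}) \<or>
      (t \<in> {0, w 2, - w 2} \<or> t' \<in> {0, w 2, - w 2})"
    by (cases a; cases a'; cases b; cases b'; cases c; cases c';
        simp add: signed_def t_def t'_def dbl algebra_simps)
  then show False using key[of t] key[of t'] tP no[of 3 0 4] no[of 3 1 4] no[of 3 2 4] by auto
qed

lemma card_gen_insert_le: "subsp P \<Longrightarrow> finite P \<Longrightarrow> card (gen (insert x P)) \<le> 3 * card P"
  using card_gen_insert_cases[of P x] by (auto simp: gen_subsp)

lemma card_gen_insert2_le:
  assumes "subsp P" "finite P"
  shows "card (gen (insert x (insert y P))) \<le> 9 * card P"
  using card_gen_insert_le[OF subsp_gen finite_gen, of "insert y P" x]
    card_gen_insert_le[OF assms, of y] assms(2) by (simp add: gen_insert_gen)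

lemma no_six_uniform_spanning:
  fixes w :: "'i \<Rightarrow> 'a::exponent3"
  assumes P: "subsp P" "finite P" and X: "card X = 6" and s: "s \<in> {2, 3, 4}"
    and span: "\<And>Y. Y \<subseteq> X \<Longrightarrow> card Y = s \<Longrightarrow> gen (P \<union> w ` Y) = W"
    and card: "3 ^ s * card P \<le> card W"
  shows False
proof -
  have "finite X" using X card.infinite by fastforce
  then obtain e where "bij_betw e {0..<card X} X" using ex_bij_betw_nat_finite by blast
  then have e: "inj_on e {0..<6}" "e ` {0..<6} = X" by (auto simp: X bij_betw_def)
  have eX: "e i \<in> X" if "i < 6" for i using that e(2) by auto
  have eeq: "e i = e j \<longleftrightarrow> i = j" if "i < 6" "j < 6" for i j
    using inj_on_eq_iff[OF e(1)] that by auto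
  have P0: "0 < card P" using P subsp_0 by (auto simp: card_gt_0_iff)
  consider "s = 2" | "s = 3" | "s = 4" using s by blast
  then show False
  proof cases
    case 1
    show False
    proof (rule no_five_pairwise_spanning[OF P(1), of "w \<circ> e" W])
      fix i j :: nat assume "i < 5" "j < 5" "i \<noteq> j"
      then show "gen (P \<union> (w \<circ> e) ` {i, j}) = W"
        using span[of "{e i, e j}"] 1 by (simp add: eX eeq)
    next
      fix x show "gen (insert x P) \<noteq> W"
        using card_gen_insert_le[OF P, of x] card 1 P0 by auto
    qed
  next
    case 2
    show False
    proof (rule no_five_triplewise_spanning[OF P(1), of "w \<circ> e" W])
      fix i j k :: nat assume "i < 5" "j < 5" "k < 5" "i \<noteq> j" "i \<noteq> k" "j \<noteq> k"
      then show "gen (P \<union> (w \<circ> e) ` {i, j, k}) = W"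
        using span[of "{e i, e j, e k}"] 2 by (simp add: eX eeq)
    next
      fix x y show "gen (insert x (insert y P)) \<noteq> W"
        using card_gen_insert2_le[OF P, of x y] card 2 P0 by auto
    qed
  next
    case 3
    define Q where "Q = gen (insert (w (e 5)) P)"
    show False
    proof (rule no_five_triplewise_spanning[of Q "w \<circ> e" W])
      show "subsp Q" by (simp add: Q_def subsp_gen)
      fix i j k :: nat assume ijk: "i < 5" "j < 5" "k < 5" "i \<noteq> j" "i \<noteq> k" "j \<noteq> k"
      then have "gen (P \<union> w ` {e 5, e i, e j, e k}) = W"
        using span[of "{e 5, e i, e j, e k}"] 3 by (simp add: eX eeq)
      moreover have "gen (Q \<union> (w \<circ> e) ` {i, j, k}) = gen (P \<union> w ` {e 5, e i, e j, e k})"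
        unfolding Q_def gen_gen_Un by (simp add: insert_commute)
      ultimately show "gen (Q \<union> (w \<circ> e) ` {i, j, k}) = W" by simp
    next
      fix x y
      have "card (gen (insert x (insert y Q))) \<le> 9 * card Q"
        unfolding Q_def using P(2) by (intro card_gen_insert2_le subsp_gen finite_gen) simp
      also have "\<dots> \<le> 27 * card P" using card_gen_insert_le[OF P, of "w (e 5)"] by (simp add: Q_def)
      also have "\<dots> < card W" using card 3 P0 by simp
      finally show "gen (insert x (insert y Q)) \<noteq> W" by auto
    qed
  qed
qed

section \<open>Good sets\<close>

text \<open>The witness \<open>U\<close> is necessarily the span of the first components, and the lattice generated by
  \<open>m + t n\<close> for \<open>(m, n) \<in> u ` S\<close> is then \<open>{m + t n. m \<in> U}\<close>.\<close>

definition good :: "'a::exponent3 set \<Rightarrow> ('i \<Rightarrow> 'a \<times> 'a) \<Rightarrow> 'i set \<Rightarrow> bool" where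
  "good V u S \<longleftrightarrow> (\<exists>U. subsp U \<and> U \<subseteq> V \<and> (card U = card V \<or> 9 * card U = card V) \<and>
     gen (u ` S \<union> {0} \<times> U) = U \<times> V)"

lemma gen_fst: "fst ` gen A = gen (fst ` A)"
  by (rule gen_image) simp

lemma gen_fst_eq:
  assumes "subsp U" "V \<noteq> {}" "gen (u ` S \<union> {0} \<times> U) = U \<times> V"
  shows "gen ((fst \<circ> u) ` S) = U"
proof -
  have "U = fst ` gen (u ` S \<union> {0} \<times> U)" using assms by auto
  also have "\<dots> = gen (insert 0 ((fst \<circ> u) ` S))"
    using subsp_0[OF assms(1)] unfolding gen_fst by (intro arg_cong[where f = gen]) force
  also have "\<dots> = gen ((fst \<circ> u) ` S)" by (rule gen_insert_redundant[OF subsp_0[OF subsp_gen]])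
  finally show ?thesis by simp
qed

lemma goodD:
  assumes "good V u S" "V \<noteq> {}"
  defines "U \<equiv> gen ((fst \<circ> u) ` S)"
  shows "U \<subseteq> V" "card U = card V \<or> 9 * card U = card V" "gen (u ` S \<union> {0} \<times> U) = U \<times> V"
  using assms gen_fst_eq unfolding good_def by blast+

lemma constant_on_subsets:
  assumes "finite X"
    and step: "\<And>Z x x'. Z \<subseteq> X \<Longrightarrow> Suc (card Z) = s \<Longrightarrow> x \<in> X - Z \<Longrightarrow> x' \<in> X - Z \<Longrightarrow>
      f (insert x Z) = f (insert x' Z)"
    and "Y \<subseteq> X" "Y' \<subseteq> X" "card Y = s" "card Y' = s"
  shows "f Y = f Y'"
  using assms(3,5)
proof (induction "card (Y - Y')" arbitrary: Y)
  case 0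
  have fin: "finite Y" "finite Y'" using 0 assms finite_subset by blast+
  then have "Y \<subseteq> Y'" using 0 by auto
  then have "Y = Y'" using fin 0 assms by (intro card_subset_eq) auto
  then show ?case by simp
next
  case (Suc k)
  have fin: "finite Y" "finite Y'" using Suc.prems assms finite_subset by blast+
  obtain y where y: "y \<in> Y - Y'" using Suc.hyps(2) by (metis card.empty ex_in_conv nat.distinct(1))
  have "\<not> Y' \<subseteq> Y" using y card_subset_eq[OF fin(1), of Y'] Suc.prems assms by auto
  then obtain y' where y': "y' \<in> Y' - Y" by blast
  have Y: "Y = insert y (Y - {y})" using y by auto
  have cardZ: "Suc (card (Y - {y})) = s" using y fin Suc.prems by (metis Diff_iff card.remove)
  have eq: "f Y = f (insert y' (Y - {y}))"
    using step[of "Y - {y}" y y'] Suc.prems y y' cardZ assms(4) Y by auto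
  have "insert y' (Y - {y}) - Y' = (Y - Y') - {y}" using y' by auto
  then have "k = card (insert y' (Y - {y}) - Y')" using Suc.hyps(2) y fin by simp
  moreover have "insert y' (Y - {y}) \<subseteq> X" using Suc.prems y' assms(4) by auto
  moreover have "card (insert y' (Y - {y})) = s" using y' cardZ fin by simp
  ultimately have "f (insert y' (Y - {y})) = f Y'" by (rule Suc.hyps(1))
  with eq show ?case by simp
qed

lemma card_gen_coloops:
  assumes "finite A" "finite Z" "\<And>z. z \<in> Z \<Longrightarrow> w z \<notin> gen (A \<union> w ` (Z - {z}))"
  shows "card (gen (A \<union> w ` Z)) = 3 ^ card Z * card (gen A)"
  using assms(2,3)
proof (induction Z)
  case (insert z Z)
  have "w z \<notin> gen (A \<union> w ` Z)" using insert.prems[of z] insert.hyps by auto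
  then have "card (gen (insert (w z) (gen (A \<union> w ` Z)))) = 3 * card (gen (A \<union> w ` Z))"
    using assms(1) insert.hyps by (intro card_gen_insert subsp_gen finite_gen) auto
  moreover have "card (gen (A \<union> w ` Z)) = 3 ^ card Z * card (gen A)"
  proof (rule insert.IH)
    fix z' assume "z' \<in> Z"
    then have "w z' \<notin> gen (A \<union> w ` (insert z Z - {z'}))" using insert.prems by blast
    moreover have "gen (A \<union> w ` (Z - {z'})) \<subseteq> gen (A \<union> w ` (insert z Z - {z'}))"
      by (rule gen_mono) auto
    ultimately show "w z' \<notin> gen (A \<union> w ` (Z - {z'}))" by blast
  qed
  ultimately show ?case using insert.hyps by (simp add: gen_insert_gen)
qed simp

lemma gen_coloops_fst:
  assumes "finite Y"
    and "\<And>y. y \<in> Y \<Longrightarrow> fst (u y) \<notin> gen ((fst \<circ> u) ` (R \<union> (Y - {y})))"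
    and "(0, n) \<in> gen (u ` (R \<union> Y))"
  shows "(0, n) \<in> gen (u ` R)"
  using assms
proof (induction Y)
  case (insert y Y)
  have gf: "fst ` gen (u ` (R \<union> Y)) = gen ((fst \<circ> u) ` (R \<union> Y))"
    by (simp add: gen_fst image_comp)
  have y: "fst (u y) \<notin> gen ((fst \<circ> u) ` (R \<union> Y))" using insert.prems(1)[of y] insert.hyps by simp
  have "(0, n) \<in> gen (insert (u y) (gen (u ` (R \<union> Y))))"
    using insert.prems(2) by (simp add: gen_insert_gen)
  then consider "(0, n) \<in> gen (u ` (R \<union> Y))" | "(0, n) - u y \<in> gen (u ` (R \<union> Y))"
    | "(0, n) + u y \<in> gen (u ` (R \<union> Y))"
    by (auto simp: mem_gen_insert subsp_gen)
  then have "(0, n) \<in> gen (u ` (R \<union> Y))"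
  proof cases
    case 2
    then have "fst ((0, n) - u y) \<in> gen ((fst \<circ> u) ` (R \<union> Y))" unfolding gf[symmetric] by (rule imageI)
    then have "fst (u y) \<in> gen ((fst \<circ> u) ` (R \<union> Y))"
      using subsp_uminus[OF subsp_gen] by fastforce
    with y show ?thesis ..
  next
    case 3
    then have "fst ((0, n) + u y) \<in> gen ((fst \<circ> u) ` (R \<union> Y))" unfolding gf[symmetric] by (rule imageI)
    with y show ?thesis by simp
  qed
  then show ?case
  proof (rule insert.IH[rotated])
    fix z assume "z \<in> Y"
    then have "fst (u z) \<notin> gen ((fst \<circ> u) ` (R \<union> (insert y Y - {z})))" using insert.prems by blast
    moreover have "gen ((fst \<circ> u) ` (R \<union> (Y - {z}))) \<subseteq> gen ((fst \<circ> u) ` (R \<union> (insert y Y - {z})))"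
      by (rule gen_mono) auto
    ultimately show "fst (u z) \<notin> gen ((fst \<circ> u) ` (R \<union> (Y - {z})))" by blast
  qed
qed simp

lemma card_eq_kernel_times_image:
  assumes "subsp Q" "finite Q"
  shows "card Q = card {n. (0, n) \<in> Q} * card (fst ` Q)"
proof -
  have "card {q \<in> Q. fst q = m} = card {n. (0, n) \<in> Q}" if "m \<in> fst ` Q" for m
  proof -
    from that obtain p where "m = fst p" and pQ: "p \<in> Q" by (rule imageE)
    then have p: "p \<in> Q" "fst p = m" by simp_all
    have "{q \<in> Q. fst q = m} = (\<lambda>n. p + (0, n)) ` {n. (0, n) \<in> Q}"
    proof (intro equalityI subsetI)
      fix q assume "q \<in> {q \<in> Q. fst q = m}"
      then have "q = p + (0, snd q - snd p)" "q - p = (0, snd q - snd p)" "q \<in> Q"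
        using p by (auto simp: prod_eq_iff)
      moreover then have "(0, snd q - snd p) \<in> Q" using subsp_diff[OF assms(1), of q p] p by metis
      ultimately show "q \<in> (\<lambda>n. p + (0, n)) ` {n. (0, n) \<in> Q}" by blast
    next
      fix q assume "q \<in> (\<lambda>n. p + (0, n)) ` {n. (0, n) \<in> Q}"
      then show "q \<in> {q \<in> Q. fst q = m}" using p subsp_add[OF assms(1) p(1)] by auto
    qed
    then show ?thesis by (simp add: card_image inj_on_def)
  qed
  then have "(\<Sum>m\<in>fst ` Q. card {q \<in> Q. fst q = m}) = card (fst ` Q) * card {n. (0, n) \<in> Q}"
    by simp
  moreover have "(\<Sum>m\<in>fst ` Q. card {q \<in> Q. fst q = m}) = card Q"
  proof -
    have "card Q = card (\<Union>m\<in>fst ` Q. {q \<in> Q. fst q = m})" by (rule arg_cong[where f = card]) auto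
    also have "\<dots> = (\<Sum>m\<in>fst ` Q. card {q \<in> Q. fst q = m})"
      using assms(2) by (intro card_UN_disjoint) auto
    finally show ?thesis by simp
  qed
  ultimately show ?thesis by (simp add: mult.commute)
qed

lemma card_gen_Un_le:
  assumes "subsp A" "subsp B" "finite A" "finite B"
  shows "card (gen (A \<union> B)) \<le> card A * card B"
proof -
  have "gen (A \<union> B) = (\<lambda>(a, b). a + b) ` (A \<times> B)" by (auto simp: gen_Un_subsp[OF assms(1,2)])
  then show ?thesis using card_image_le[of "A \<times> B" "\<lambda>(a, b). a + b"] assms(3,4)
    by (simp add: card_cartesian_product)
qed

lemma not_all_good:
  fixes V :: "'a::exponent3 set" and u :: "'i \<Rightarrow> 'a \<times> 'a"
  assumes V: "subsp V" "finite V" "card V = 3 ^ r"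
    and R: "finite R" "card R + s = r" and X: "card X = 6" and s: "s \<in> {2, 3, 4}"
    and good: "\<And>Y. Y \<subseteq> X \<Longrightarrow> card Y = s \<Longrightarrow> good V u (R \<union> Y)"
  shows False
proof -
  define m where "m = fst \<circ> u"
  define U where "U Y = gen (m ` (R \<union> Y))" for Y
  have finX: "finite X" using X card.infinite by fastforce
  have V0: "V \<noteq> {}" using V subsp_0 by blast
  have UV: "U Y \<subseteq> V" and Ucard: "card (U Y) = card V \<or> 9 * card (U Y) = card V"
    and Uspan: "gen (u ` (R \<union> Y) \<union> {0} \<times> U Y) = U Y \<times> V" if "Y \<subseteq> X" "card Y = s" for Y
    using goodD[OF good[OF that] V0] by (auto simp: U_def m_def)
  have finU: "finite (U Y)" if "Y \<subseteq> X" for Y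
    unfolding U_def using R finite_subset[OF that finX] by (intro finite_gen) auto
  have Upos: "0 < card (U Y)" if "Y \<subseteq> X" for Y
    using finU[OF that] subsp_0[OF subsp_gen] unfolding U_def by (auto simp: card_gt_0_iff)
  have U_insert: "U (insert x Z) = gen (insert (m x) (m ` (R \<union> Z)))" for x Z by (simp add: U_def)
  have card_const: "card (U Y) = card (U Y')"
    if "Y \<subseteq> X" "Y' \<subseteq> X" "card Y = s" "card Y' = s" for Y Y'
  proof (rule constant_on_subsets[OF finX _ that])
    fix Z x x' assume Z: "Z \<subseteq> X" "Suc (card Z) = s" "x \<in> X - Z" "x' \<in> X - Z"
    have finZ: "finite Z" using Z finX finite_subset by blast
    have xZ: "insert x Z \<subseteq> X" "card (insert x Z) = s" "insert x' Z \<subseteq> X" "card (insert x' Z) = s"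
      using Z finZ by auto
    have fin: "finite (m ` (R \<union> Z))" using R finZ by simp
    show "card (U (insert x Z)) = card (U (insert x' Z))"
      using card_gen_insert_cases[OF fin, of "m x"] card_gen_insert_cases[OF fin, of "m x'"]
        Ucard[OF xZ(1,2)] Ucard[OF xZ(3,4)] Upos[OF xZ(1)] Upos[OF xZ(3)]
      unfolding U_insert by auto
  qed
  have card_uR: "card (gen (u ` R)) \<le> 3 ^ card R"
    using card_gen_Un_image_le[of "{}" R u] R(1) by (simp add: gen_empty)
  show False
  proof (cases "\<exists>Z x x'. Z \<subseteq> X \<and> Suc (card Z) = s \<and> x \<in> X - Z \<and> x' \<in> X - Z \<and>
      U (insert x Z) \<noteq> U (insert x' Z)")
    case False
    \<comment> \<open>The common lattice modulo \<open>t\<close> is \<open>U \<times> V / U\<close>.\<close>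
    have "s \<le> card X" using X s by auto
    then obtain Y0 where Y0: "Y0 \<subseteq> X" "card Y0 = s" by (rule obtain_subset_with_card_n)
    have const: "U Y = U Y0" if "Y \<subseteq> X" "card Y = s" for Y
      using False by (intro constant_on_subsets[OF finX _ that(1) Y0(1) that(2) Y0(2)]) blast
    define P where "P = gen ({0} \<times> U Y0 \<union> u ` R)"
    have sub0: "subsp ({0 :: 'a} \<times> U Y0)"
      by (rule subsp_Times) (simp_all add: U_def subsp_gen subsp_def[of "{0}"])
    show False
    proof (rule no_six_uniform_spanning[OF _ _ X s, of P u "U Y0 \<times> V"])
      show "subsp P" by (simp add: P_def subsp_gen)
      show "finite P" unfolding P_def using finU[OF Y0(1)] R by (intro finite_gen) auto
      show "gen (P \<union> u ` Y) = U Y0 \<times> V" if "Y \<subseteq> X" "card Y = s" for Y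
        using Uspan[OF that] const[OF that] unfolding P_def gen_gen_Un
        by (simp add: image_Un Un_ac)
      have "card P \<le> 3 ^ card R * card (gen ({0 :: 'a} \<times> U Y0))"
        unfolding P_def using finU[OF Y0(1)] R(1) by (intro card_gen_Un_image_le) auto
      then have "card P \<le> 3 ^ card R * card (U Y0)"
        by (simp add: gen_subsp[OF sub0] card_cartesian_product)
      then have "3 ^ s * card P \<le> 3 ^ s * (3 ^ card R * card (U Y0))" by simp
      also have "\<dots> = card (U Y0 \<times> V)"
        by (simp add: card_cartesian_product V(3) R(2)[symmetric] power_add)
      finally show "3 ^ s * card P \<le> card (U Y0 \<times> V)" .
    qed
  next
    case True
    \<comment> \<open>All linear relations among the first components live on \<open>R\<close>, so the set \<open>K\<close> below is what
      remains of \<open>u ` R\<close> after dividing these relations by \<open>t\<close>, and \<open>X\<close> is considered modulo \<open>P\<close>.\<close>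
    then obtain Z x x' where Z: "Z \<subseteq> X" "Suc (card Z) = s" "x \<in> X - Z" "x' \<in> X - Z"
      and neq: "U (insert x Z) \<noteq> U (insert x' Z)" by blast
    have finZ: "finite Z" using Z finX finite_subset by blast
    have xZ: "insert x Z \<subseteq> X" "card (insert x Z) = s" "insert x' Z \<subseteq> X" "card (insert x' Z) = s"
      using Z finZ by auto
    define k where "k = card (U (insert x Z))"
    have k: "card (U Y) = k" if "Y \<subseteq> X" "card Y = s" for Y
      unfolding k_def using card_const that xZ by blast
    have not_both: "\<not> (U (insert x Z) \<subseteq> U Y \<and> U (insert x' Z) \<subseteq> U Y)" if "Y \<subseteq> X" "card Y = s" for Y
      using neq card_subset_eq[OF finU[OF that(1)], of "U (insert x Z)"]
        card_subset_eq[OF finU[OF that(1)], of "U (insert x' Z)"] k that xZ by metis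
    have coloopZ: "m z \<notin> gen (m ` R \<union> m ` (Z - {z}))" if z: "z \<in> Z" for z
    proof
      assume mz: "m z \<in> gen (m ` R \<union> m ` (Z - {z}))"
      define Y where "Y = insert x (insert x' (Z - {z}))"
      have xx: "x \<noteq> x'" using neq by auto
      have "Suc (card (Z - {z})) = card Z" using card.remove[OF finZ z] by simp
      moreover have "x' \<notin> Z - {z}" "x \<notin> insert x' (Z - {z})" using Z xx by auto
      ultimately have "card Y = s" using finZ Z(2) by (simp add: Y_def)
      moreover have "Y \<subseteq> X" using Z by (auto simp: Y_def)
      ultimately have Y: "Y \<subseteq> X" "card Y = s" by simp_all
      have "gen (m ` R \<union> m ` (Z - {z})) \<subseteq> U Y"
        unfolding U_def Y_def by (rule gen_mono) auto
      then have "m z \<in> U Y" using mz by blast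
      moreover have "m ` (R \<union> Y) \<subseteq> U Y" by (simp add: U_def gen_superset)
      ultimately have "m ` (R \<union> insert x Z) \<subseteq> U Y" "m ` (R \<union> insert x' Z) \<subseteq> U Y"
        unfolding Y_def by blast+
      moreover have "subsp (U Y)" by (simp add: U_def subsp_gen)
      ultimately have "U (insert x Z) \<subseteq> U Y" "U (insert x' Z) \<subseteq> U Y"
        unfolding U_def[of "insert x Z"] U_def[of "insert x' Z"] by (simp_all add: gen_minimal)
      then show False using not_both[OF Y] by blast
    qed
    have "m x \<notin> gen (m ` (R \<union> Z))"
    proof
      assume "m x \<in> gen (m ` (R \<union> Z))"
      then have "U (insert x Z) = U Z" unfolding U_insert U_def[of Z] by (rule gen_insert_redundant)
      moreover have "U Z \<subseteq> U (insert x' Z)" unfolding U_def by (rule gen_mono) auto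
      ultimately show False using not_both[OF xZ(3,4)] by blast
    qed
    then have "k = 3 * card (gen (m ` (R \<union> Z)))"
      unfolding k_def U_insert gen_insert_gen[of "m x" "m ` (R \<union> Z)", symmetric]
      using R finZ by (intro card_gen_insert subsp_gen finite_gen) auto
    also have "card (gen (m ` (R \<union> Z))) = 3 ^ card Z * card (gen (m ` R))"
      using card_gen_coloops[of "m ` R" Z m] coloopZ R finZ by (simp add: image_Un)
    finally have ke: "k = 3 ^ s * card (gen (m ` R))" using Z(2) by (metis mult.assoc power_Suc)
    have coloop: "m y \<notin> gen (m ` (R \<union> (Y - {y})))" if Y: "Y \<subseteq> X" "card Y = s" and y: "y \<in> Y" for Y y
    proof
      assume "m y \<in> gen (m ` (R \<union> (Y - {y})))"
      then have "gen (insert (m y) (m ` (R \<union> (Y - {y})))) = gen (m ` (R \<union> (Y - {y})))"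
        by (rule gen_insert_redundant)
      moreover have "insert (m y) (m ` (R \<union> (Y - {y}))) = m ` (R \<union> Y)" using y by auto
      ultimately have "U Y = gen (m ` R \<union> m ` (Y - {y}))" by (simp add: U_def image_Un)
      then have "k \<le> 3 ^ card (Y - {y}) * card (gen (m ` R))"
        using k[OF Y] card_gen_Un_image_le[of "m ` R" "Y - {y}" m] R finite_subset[OF Y(1) finX] by auto
      moreover have "Suc (card (Y - {y})) = s" using y Y finite_subset[OF Y(1) finX] by (metis card.remove)
      then have "3 ^ s = 3 * (3::nat) ^ card (Y - {y})" by (metis power_Suc)
      moreover have "0 < k" using Upos[OF xZ(1)] k_def by simp
      ultimately show False using ke by auto
    qed
    define K where "K = {n. (0, n) \<in> gen (u ` R)}"
    define P where "P = gen (K \<union> m ` R)"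
    have finuR: "finite (gen (u ` R))" using R by (intro finite_gen) simp
    have subK: "subsp K" using subsp_gen[of "u ` R"] unfolding K_def subsp_def
      by (auto simp: zero_prod_def) (metis add.right_neutral add_Pair)
    have "K \<subseteq> snd ` gen (u ` R)" by (force simp: K_def)
    then have finK: "finite K" using finuR finite_subset by blast
    show False
    proof (rule no_six_uniform_spanning[OF _ _ X s, of P m V])
      show "subsp P" by (simp add: P_def subsp_gen)
      show "finite P" unfolding P_def using finK R by (intro finite_gen) auto
      have "card P \<le> card K * card (gen (m ` R))"
        using card_gen_Un_le[OF subK subsp_gen finK finite_gen, of "m ` R"] gen_gen_Un[of "m ` R" K] R
        by (simp add: P_def Un_commute)
      also have "\<dots> = card (gen (u ` R))"
        using card_eq_kernel_times_image[OF subsp_gen finuR] by (simp add: K_def gen_fst m_def image_comp)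
      also note card_uR
      finally have "3 ^ s * card P \<le> 3 ^ s * 3 ^ card R" by simp
      then show "3 ^ s * card P \<le> card V" by (simp add: V(3) R(2)[symmetric] power_add)
      fix Y assume Y: "Y \<subseteq> X" "card Y = s"
      have finY: "finite Y" using finite_subset[OF Y(1) finX] .
      show "gen (P \<union> m ` Y) = V"
      proof
        have "u ` (R \<union> Y) \<subseteq> U Y \<times> V" unfolding Uspan[OF Y, symmetric] by (auto intro: gen_base)
        then have "u ` R \<subseteq> V \<times> V" using UV[OF Y] by auto
        moreover have "m ` (R \<union> Y) \<subseteq> U Y" by (simp add: U_def gen_superset)
        ultimately have uV: "u ` R \<subseteq> V \<times> V" "m ` (R \<union> Y) \<subseteq> V" using UV[OF Y] by auto
        then have "gen (u ` R) \<subseteq> V \<times> V" by (intro gen_minimal subsp_Times V)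
        then have "K \<subseteq> V" by (auto simp: K_def)
        then have "gen (K \<union> (m ` R \<union> m ` Y)) \<subseteq> V" using uV by (intro gen_minimal V) auto
        then show "gen (P \<union> m ` Y) \<subseteq> V" by (simp add: P_def gen_gen_Un Un_assoc)
        show "V \<subseteq> gen (P \<union> m ` Y)"
        proof
          fix v assume "v \<in> V"
          moreover have "0 \<in> U Y" by (simp add: U_def subsp_0 subsp_gen)
          ultimately have "(0, v) \<in> gen (gen (u ` (R \<union> Y)) \<union> {0} \<times> U Y)"
            using Uspan[OF Y] by (simp add: gen_gen_Un)
          moreover have "subsp ({0 :: 'a} \<times> U Y)"
            by (rule subsp_Times) (simp_all add: U_def subsp_gen subsp_def[of "{0}"])
          ultimately obtain a b where ab: "(0, v) = a + b" "a \<in> gen (u ` (R \<union> Y))" "b \<in> {0} \<times> U Y"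
            using gen_Un_subsp[OF subsp_gen] by blast
          then have a: "a = (0, snd a)" and v: "v = snd a + snd b" and b: "snd b \<in> U Y"
            by (auto simp: prod_eq_iff)
          have "(0, snd a) \<in> gen (u ` R)"
            using gen_coloops_fst[OF finY, of u R "snd a"] coloop[OF Y] ab(2) a
            by (simp add: m_def)
          then have "snd a \<in> K" by (simp add: K_def)
          then have "snd a \<in> gen (P \<union> m ` Y)" by (auto simp: P_def intro: gen_base)
          moreover have "U Y \<subseteq> gen (K \<union> m ` R \<union> m ` Y)" unfolding U_def by (rule gen_mono) auto
          then have "snd b \<in> gen (P \<union> m ` Y)" using b by (auto simp: P_def gen_gen_Un)
          ultimately show "v \<in> gen (P \<union> m ` Y)" unfolding v by (intro subsp_add subsp_gen)
        qed
      qed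
    qed
  qed
qed

section \<open>Counting good labellings\<close>

lemma card_independent_functions:
  fixes B W :: "'a::exponent3 set" and S :: "'i set"
  assumes W: "subsp W" "finite W" and B: "subsp B" "B \<subseteq> W" and S: "finite S"
  shows "card {w \<in> S \<rightarrow>\<^sub>E W. card (gen (B \<union> w ` S)) = 3 ^ card S * card B}
    = (\<Prod>i<card S. card W - 3 ^ i * card B)"
  using S
proof (induction S)
  case empty
  then show ?case by (simp add: gen_subsp[OF B(1)])
next
  case (insert x S)
  define I where "I T = {w \<in> T \<rightarrow>\<^sub>E W. card (gen (B \<union> w ` T)) = 3 ^ card T * card B}" for T :: "'i set"
  have finB: "finite B" using B W finite_subset by blast
  have B0: "0 < card B" using finB subsp_0[OF B(1)] by (auto simp: card_gt_0_iff)
  have genW: "gen (B \<union> w ` S) \<subseteq> W" if "w \<in> S \<rightarrow>\<^sub>E W" for w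
    using that B(2) by (intro gen_minimal W) (auto simp: PiE_iff)
  have img: "w(x := a) ` insert x S = insert a (w ` S)" for w :: "'i \<Rightarrow> 'a" and a
    using insert.hyps by auto
  have iff: "card (gen (B \<union> insert a (w ` S))) = 3 ^ card (insert x S) * card B \<longleftrightarrow>
      card (gen (B \<union> w ` S)) = 3 ^ card S * card B \<and> a \<notin> gen (B \<union> w ` S)" for w a
  proof (cases "a \<in> gen (B \<union> w ` S)")
    case True
    have "card (gen (B \<union> w ` S)) \<le> 3 ^ card S * card B"
      using card_gen_Un_image_le[OF finB insert.hyps(1), of w] by (simp add: gen_subsp[OF B(1)])
    then show ?thesis using True B0 insert.hyps gen_insert_redundant[OF True] by auto
  next
    case False
    have "card (gen (insert a (gen (B \<union> w ` S)))) = 3 * card (gen (B \<union> w ` S))"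
      using False finB insert.hyps by (intro card_gen_insert subsp_gen finite_gen) auto
    then show ?thesis using False insert.hyps by (auto simp: gen_insert_gen)
  qed
  have mem: "w(x := a) \<in> I (insert x S) \<longleftrightarrow> w \<in> I S \<and> a \<in> W - gen (B \<union> w ` S)"
    if w: "w \<in> S \<rightarrow>\<^sub>E W" for w a
  proof -
    have "w(x := a) \<in> insert x S \<rightarrow>\<^sub>E W \<longleftrightarrow> a \<in> W"
      using w insert.hyps(2) by (auto simp: PiE_iff extensional_def)
    then show ?thesis unfolding I_def mem_Collect_eq img iff using w by blast
  qed
  have "I (insert x S) = (\<lambda>(w, a). w(x := a)) ` (SIGMA w:I S. W - gen (B \<union> w ` S))"
  proof (intro equalityI subsetI)
    fix v assume v: "v \<in> I (insert x S)"
    then obtain a w where aw: "a \<in> W" "w \<in> S \<rightarrow>\<^sub>E W" "v = w(x := a)"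
      by (auto simp: I_def PiE_insert_eq)
    then have "w \<in> I S" "a \<in> W - gen (B \<union> w ` S)" using v mem by blast+
    then show "v \<in> (\<lambda>(w, a). w(x := a)) ` (SIGMA w:I S. W - gen (B \<union> w ` S))"
      using aw(3) by force
  next
    fix v assume "v \<in> (\<lambda>(w, a). w(x := a)) ` (SIGMA w:I S. W - gen (B \<union> w ` S))"
    then obtain a w where aw: "w \<in> I S" "a \<in> W - gen (B \<union> w ` S)" "v = w(x := a)" by auto
    moreover have "w \<in> S \<rightarrow>\<^sub>E W" using aw(1) by (simp add: I_def)
    ultimately show "v \<in> I (insert x S)" using mem by blast
  qed
  moreover have "inj_on (\<lambda>(w, a). w(x := a)) (SIGMA w:I S. W - gen (B \<union> w ` S))"
  proof (rule inj_onI, clarify)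
    fix w a v b assume w: "w \<in> I S" and v: "v \<in> I S" and eq: "w(x := a) = v(x := b)"
    have "w x = undefined" "v x = undefined" using w v insert.hyps by (auto simp: I_def PiE_iff extensional_def)
    then have "w = v" using eq by (metis fun_upd_triv fun_upd_upd)
    then show "w = v \<and> a = b" using eq by (metis fun_upd_same)
  qed
  ultimately have "card (I (insert x S)) = card (SIGMA w:I S. W - gen (B \<union> w ` S))"
    by (simp add: card_image)
  also have "\<dots> = (\<Sum>w\<in>I S. card (W - gen (B \<union> w ` S)))"
    using W finite_PiE[OF insert.hyps(1), of "\<lambda>_. W"] by (intro card_SigmaI) (auto simp: I_def)
  also have "\<dots> = (\<Sum>w\<in>I S. card W - 3 ^ card S * card B)"
  proof (rule sum.cong[OF refl])
    fix w assume "w \<in> I S"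
    then have "w \<in> S \<rightarrow>\<^sub>E W" "card (gen (B \<union> w ` S)) = 3 ^ card S * card B" by (auto simp: I_def)
    then show "card (W - gen (B \<union> w ` S)) = card W - 3 ^ card S * card B"
      using genW[of w] finite_subset[OF genW W(2)] by (simp add: card_Diff_subset)
  qed
  also have "\<dots> = card (I S) * (card W - 3 ^ card S * card B)" by simp
  finally show ?case using insert.IH insert.hyps by (simp add: I_def)
qed

definition gl_card :: "nat \<Rightarrow> nat" where
  "gl_card r = (\<Prod>i<r. 3 ^ r - 3 ^ i)"

lemma card_spanning_functions:
  fixes B W :: "'a::exponent3 set" and S :: "'i set"
  assumes W: "subsp W" "finite W" and B: "subsp B" "B \<subseteq> W" and S: "finite S"
    and card: "card W = 3 ^ card S * card B"
  shows "card {w \<in> S \<rightarrow>\<^sub>E W. gen (B \<union> w ` S) = W} = card B ^ card S * gl_card (card S)"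
proof -
  have "gen (B \<union> w ` S) = W \<longleftrightarrow> card (gen (B \<union> w ` S)) = 3 ^ card S * card B"
    if "w \<in> S \<rightarrow>\<^sub>E W" for w
  proof -
    have "gen (B \<union> w ` S) \<subseteq> W" using that B(2) by (intro gen_minimal W) (auto simp: PiE_iff)
    then show ?thesis using card_subset_eq[OF W(2)] unfolding card[symmetric] by blast
  qed
  then have "{w \<in> S \<rightarrow>\<^sub>E W. gen (B \<union> w ` S) = W}
      = {w \<in> S \<rightarrow>\<^sub>E W. card (gen (B \<union> w ` S)) = 3 ^ card S * card B}"
    by (intro Collect_cong conj_cong refl)
  then have "card {w \<in> S \<rightarrow>\<^sub>E W. gen (B \<union> w ` S) = W} = (\<Prod>i<card S. card W - 3 ^ i * card B)"
    by (simp only: card_independent_functions[OF W B S])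
  also have "\<dots> = (\<Prod>i<card S. card B * (3 ^ card S - 3 ^ i))"
    unfolding card by (simp add: diff_mult_distrib2 mult.commute)
  also have "\<dots> = card B ^ card S * gl_card (card S)"
    by (simp add: prod.distrib gl_card_def)
  finally show ?thesis .
qed

lemma real_pow3_diff: "i \<le> k \<Longrightarrow> real (3 ^ k - 3 ^ i) = 3 ^ k - 3 ^ i"
  by (simp add: of_nat_diff power_increasing)

lemma gl_card_pos: "0 < gl_card r"
  by (auto simp: gl_card_def intro!: prod_pos)

lemma prod_codim2_identity:
  "(\<Prod>i<m. 3 ^ (m + 2) - 3 ^ i) * 16 = (\<Prod>i<m. 3 ^ m - 3 ^ i) * (3 ^ (m + 2) - 1) * (3 ^ (m + 1) - 1 :: real)"
proof (induction m)
  case (Suc m)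
  have shift: "(\<Prod>i<Suc m. 3 ^ Suc k - 3 ^ i) = (3 ^ Suc k - 1) * (3 ^ m * (\<Prod>i<m. 3 ^ k - 3 ^ i :: real))" for k
  proof -
    have "(\<Prod>i<m. 3 ^ Suc k - 3 ^ Suc i) = (\<Prod>i<m. 3 * (3 ^ k - 3 ^ i :: real))"
      by (simp add: algebra_simps)
    then show ?thesis
      unfolding prod.lessThan_Suc_shift by (simp only: prod.distrib) simp
  qed
  have "(\<Prod>i<Suc m. 3 ^ (Suc m + 2) - 3 ^ i :: real) * 16
      = (3 ^ Suc (m + 2) - 1) * 3 ^ m * ((\<Prod>i<m. 3 ^ (m + 2) - 3 ^ i) * 16)"
    using shift[of "m + 2"] by simp
  also have "\<dots> = (3 ^ Suc (m + 2) - 1) * 3 ^ m *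
      ((\<Prod>i<m. 3 ^ m - 3 ^ i) * (3 ^ (m + 2) - 1) * (3 ^ (m + 1) - 1 :: real))"
    by (simp only: Suc.IH)
  also have "\<dots> = (\<Prod>i<Suc m. 3 ^ Suc m - 3 ^ i) * (3 ^ (Suc m + 2) - 1) * (3 ^ (Suc m + 1) - 1)"
    unfolding shift[of m] by (simp add: mult_ac)
  finally show ?case .
qed simp

lemma card_codim2:
  fixes V :: "'a::exponent3 set"
  assumes V: "subsp V" "finite V" "card V = 3 ^ (m + 2)"
  shows "16 * real (card {U. subsp U \<and> U \<subseteq> V \<and> card U = 3 ^ m}) = (3 ^ (m + 2) - 1) * (3 ^ (m + 1) - 1)"
proof -
  let ?UU = "{U. subsp U \<and> U \<subseteq> V \<and> card U = 3 ^ m}"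
  let ?T = "{..<m}"
  have sub0: "subsp {0 :: 'a}" by (simp add: subsp_def)
  have finUU: "finite ?UU" by (rule finite_subset[of _ "Pow V"]) (use V in auto)
  define F where "F U = {w \<in> ?T \<rightarrow>\<^sub>E U. gen ({0} \<union> w ` ?T) = U}" for U :: "'a set"
  have cardF: "card (F U) = gl_card m" if "U \<in> ?UU" for U
    using that card_spanning_functions[of U "{0}" ?T] sub0 finite_subset[OF _ V(2), of U]
    by (simp add: F_def subsp_0)
  have finF: "finite (F U)" if "U \<in> ?UU" for U
    using that finite_subset[OF _ V(2), of U] finite_PiE[of ?T "\<lambda>_. U"] by (simp add: F_def)
  have "{w \<in> ?T \<rightarrow>\<^sub>E V. card (gen ({0} \<union> w ` ?T)) = 3 ^ card ?T * card {0 :: 'a}} = (\<Union>U\<in>?UU. F U)"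
  proof (intro equalityI subsetI)
    fix w assume w: "w \<in> {w \<in> ?T \<rightarrow>\<^sub>E V. card (gen ({0} \<union> w ` ?T)) = 3 ^ card ?T * card {0 :: 'a}}"
    define U where "U = gen ({0} \<union> w ` ?T)"
    have "U \<subseteq> V" unfolding U_def using w subsp_0[OF V(1)] by (intro gen_minimal V) (auto simp: PiE_iff)
    then have "U \<in> ?UU" using w by (simp add: U_def subsp_gen)
    moreover have "{0} \<union> w ` ?T \<subseteq> U" unfolding U_def by (rule gen_superset)
    then have "w \<in> F U" using w by (auto simp: F_def PiE_iff U_def)
    ultimately show "w \<in> (\<Union>U\<in>?UU. F U)" by blast
  next
    fix w assume "w \<in> (\<Union>U\<in>?UU. F U)"
    then show "w \<in> {w \<in> ?T \<rightarrow>\<^sub>E V. card (gen ({0} \<union> w ` ?T)) = 3 ^ card ?T * card {0 :: 'a}}"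
      by (auto simp: F_def PiE_iff)
  qed
  then have "(\<Prod>i<m. 3 ^ (m + 2) - 3 ^ i) = card (\<Union>U\<in>?UU. F U)"
    using card_independent_functions[OF V(1,2) sub0, of ?T] V(3) subsp_0[OF V(1)] by simp
  also have "\<dots> = (\<Sum>U\<in>?UU. card (F U))"
    using finUU finF by (intro card_UN_disjoint) (auto simp: F_def)
  also have "\<dots> = card ?UU * gl_card m" using cardF by simp
  finally have "real (\<Prod>i<m. 3 ^ (m + 2) - 3 ^ i) = real (card ?UU) * real (gl_card m)" by simp
  moreover have "real (\<Prod>i<m. 3 ^ (m + 2) - 3 ^ i) = (\<Prod>i<m. 3 ^ (m + 2) - 3 ^ i)"
    unfolding of_nat_prod by (intro prod.cong refl real_pow3_diff) simp
  moreover have gl: "real (gl_card m) = (\<Prod>i<m. 3 ^ m - 3 ^ i)"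
    unfolding gl_card_def of_nat_prod by (intro prod.cong refl real_pow3_diff) simp
  ultimately have "real (gl_card m) * (16 * real (card ?UU)) =
      real (gl_card m) * ((3 ^ (m + 2) - 1) * (3 ^ (m + 1) - 1))"
    using prod_codim2_identity[of m] by (simp add: mult_ac)
  then show ?thesis using gl_card_pos[of m] by simp
qed

lemma card_good_ge:
  fixes V :: "'a::exponent3 set" and S :: "'i set"
  assumes V: "subsp V" "finite V" "card V = 3 ^ r" and S: "finite S" "card S = r"
  defines "\<U> \<equiv> {U. subsp U \<and> U \<subseteq> V \<and> 9 * card U = card V}"
  shows "gl_card r * (card V ^ r + (\<Sum>U\<in>\<U>. card U ^ r)) \<le> card {u \<in> S \<rightarrow>\<^sub>E V \<times> V. good V u S}"
proof -
  define F where "F U = {u \<in> S \<rightarrow>\<^sub>E U \<times> V. gen ({0} \<times> U \<union> u ` S) = U \<times> V}" for U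
  have V0: "V \<noteq> {}" using V subsp_0 by blast
  have fin\<U>: "finite \<U>" unfolding \<U>_def by (rule finite_subset[of _ "Pow V"]) (use V in auto)
  have VU: "V \<notin> \<U>" using V(3) by (auto simp: \<U>_def)
  have U: "subsp U" "U \<subseteq> V" "finite U" "card U = card V \<or> 9 * card U = card V" if "U \<in> insert V \<U>" for U
    using that V finite_subset[of U V] by (auto simp: \<U>_def)
  have sub0: "subsp ({0 :: 'a} \<times> U)" if "U \<in> insert V \<U>" for U
    using U(1)[OF that] by (intro subsp_Times) (simp_all add: subsp_def[of "{0}"])
  have cardF: "card (F U) = card U ^ r * gl_card r" if "U \<in> insert V \<U>" for U
    unfolding F_def
    using card_spanning_functions[OF subsp_Times[OF U(1)[OF that] V(1)] _ sub0[OF that] _ S(1)]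
      U[OF that] S(2) V subsp_0[OF U(1)[OF that]]
    by (simp add: card_cartesian_product mult.commute Sigma_mono subsp_0[OF V(1)])
  have finF: "finite (F U)" if "U \<in> insert V \<U>" for U
    using U(3)[OF that] V(2) S(1) finite_PiE[of S "\<lambda>_. U \<times> V"] by (simp add: F_def)
  have FU: "gen ((fst \<circ> u) ` S) = U" if "u \<in> F U" "U \<in> insert V \<U>" for u U
    using that U(1)[OF that(2)] V0 by (intro gen_fst_eq) (auto simp: F_def Un_commute)
  have "(\<Union>U\<in>insert V \<U>. F U) \<subseteq> {u \<in> S \<rightarrow>\<^sub>E V \<times> V. good V u S}"
  proof
    fix u assume "u \<in> (\<Union>U\<in>insert V \<U>. F U)"
    then obtain U' where u: "u \<in> F U'" "U' \<in> insert V \<U>" by blast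
    have "U' \<times> V \<subseteq> V \<times> V" using U(2)[OF u(2)] by auto
    then have "u \<in> S \<rightarrow>\<^sub>E V \<times> V" using u(1) PiE_mono[of S "\<lambda>_. U' \<times> V" "\<lambda>_. V \<times> V"] by (auto simp: F_def)
    moreover have "good V u S" unfolding good_def
      using U[OF u(2)] u(1) by (intro exI[of _ U']) (simp add: F_def Un_commute)
    ultimately show "u \<in> {u \<in> S \<rightarrow>\<^sub>E V \<times> V. good V u S}" by simp
  qed
  then have "card (\<Union>U\<in>insert V \<U>. F U) \<le> card {u \<in> S \<rightarrow>\<^sub>E V \<times> V. good V u S}"
    using V(2) S(1) finite_PiE[of S "\<lambda>_. V \<times> V"] by (intro card_mono) simp_all
  moreover have "card (\<Union>U\<in>insert V \<U>. F U) = (\<Sum>U\<in>insert V \<U>. card (F U))"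
  proof (rule card_UN_disjoint)
    show "finite (insert V \<U>)" using fin\<U> by simp
    show "\<forall>U\<in>insert V \<U>. finite (F U)" by (rule ballI, rule finF)
    show "\<forall>U\<in>insert V \<U>. \<forall>U'\<in>insert V \<U>. U \<noteq> U' \<longrightarrow> F U \<inter> F U' = {}"
    proof (intro ballI impI equals0I)
      fix U U' u assume *: "U \<in> insert V \<U>" "U' \<in> insert V \<U>" "U \<noteq> U'" and u: "u \<in> F U \<inter> F U'"
      have "U = U'" using FU[OF IntD1[OF u] *(1)] FU[OF IntD2[OF u] *(2)] by (rule trans[OF sym])
      with *(3) show False ..
    qed
  qed
  moreover have "(\<Sum>U\<in>insert V \<U>. card (F U)) = (\<Sum>U\<in>insert V \<U>. card U ^ r * gl_card r)"
    by (rule sum.cong[OF refl cardF])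
  moreover have "\<dots> = gl_card r * (card V ^ r + (\<Sum>U\<in>\<U>. card U ^ r))"
    using fin\<U> VU by (simp add: sum_distrib_left algebra_simps)
  ultimately show ?thesis by simp
qed

definition gl_density :: "nat \<Rightarrow> real" where
  "gl_density r = (\<Prod>k<r. 1 - 1 / 3 ^ Suc k)"

lemma gl_density_pos: "0 < gl_density r"
  unfolding gl_density_def by (intro prod_pos) (auto simp: field_simps intro: less_le_trans[of 1 "3::real"])

lemma gl_card_eq: "real (gl_card r) = (3 ^ r) ^ r * gl_density r"
proof -
  have "real (gl_card r) = (\<Prod>i<r. 3 ^ r - 3 ^ i)"
    unfolding gl_card_def of_nat_prod by (intro prod.cong refl real_pow3_diff) simp
  also have "\<dots> = (\<Prod>i<r. 3 ^ r * (1 - 1 / 3 ^ Suc (r - Suc i)))"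
  proof (rule prod.cong[OF refl])
    fix i assume "i \<in> {..<r}"
    then have "3 ^ r = 3 ^ i * (3 :: real) ^ Suc (r - Suc i)"
      by (simp add: power_add[symmetric] del: power_Suc)
    then show "3 ^ r - 3 ^ i = 3 ^ r * (1 - 1 / (3 :: real) ^ Suc (r - Suc i))"
      by (simp add: field_simps)
  qed
  also have "\<dots> = (3 ^ r) ^ r * gl_density r"
    unfolding gl_density_def
    by (simp add: prod.distrib prod.nat_diff_reindex[where g = "\<lambda>k. 1 - 1 / (3::real) ^ Suc k"] del: power_Suc)
  finally show ?thesis .
qed

text \<open>The term \<open>1 / (2 * 3 ^ r)\<close> makes the induction go through.\<close>

lemma gl_density_lower:
  assumes "5 \<le> r"
  shows "gl_density 5 * (485 / 486 + 1 / (2 * 3 ^ r)) \<le> gl_density r"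
  using assms
proof (induction r rule: dec_induct)
  case base
  show ?case by simp
next
  case (step r)
  define b :: real where "b = 1 / 3 ^ Suc r"
  have b0: "0 \<le> b" by (simp add: b_def)
  have "(3::real) ^ 6 \<le> 3 ^ Suc r" using step.hyps by (intro power_increasing) auto
  then have b: "b \<le> 1 / 729" by (simp add: b_def field_simps)
  have "b * b \<le> b / 729" using mult_right_mono[OF b b0] by simp
  moreover have "(485 / 486 + 3 * b / 2) * (1 - b) = 485 / 486 + 3 / 2 * b - 485 / 486 * b - 3 / 2 * (b * b)"
    by (simp add: field_simps)
  ultimately have "485 / 486 + b / 2 \<le> (485 / 486 + 3 * b / 2) * (1 - b)" by linarith
  then have "gl_density 5 * (485 / 486 + b / 2) \<le> gl_density 5 * ((485 / 486 + 3 * b / 2) * (1 - b))"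
    using gl_density_pos[of 5] by (intro mult_left_mono) auto
  also have "\<dots> = gl_density 5 * (485 / 486 + 1 / (2 * 3 ^ r)) * (1 - b)" by (simp add: b_def)
  also have "\<dots> \<le> gl_density r * (1 - b)"
    using step.IH b by (intro mult_right_mono) auto
  also have "\<dots> = gl_density (Suc r)" by (simp add: gl_density_def b_def)
  finally show ?case by (simp add: b_def field_simps)
qed

lemma good_density_lower:
  assumes "2 \<le> r"
  shows "5715 / 10000 \<le> gl_density r * (1 + (1 - 1 / 3 ^ r) * (1 / 3 - 1 / 3 ^ r) / 16)"
proof -
  have num: "gl_density 2 = 16 / 27" "gl_density 3 = 416 / 729" "gl_density 4 = 33280 / 59049"
    "gl_density 5 = 8053760 / 14348907"
    by (simp_all add: gl_density_def eval_nat_numeral)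
  consider "r = 2" | "r = 3" | "r = 4" | "5 \<le> r" using assms by linarith
  then show ?thesis
  proof cases
    case 4
    define x :: real where "x = 1 / 3 ^ r"
    have x0: "0 \<le> x" by (simp add: x_def)
    have "(3::real) ^ 5 \<le> 3 ^ r" using 4 by (intro power_increasing) auto
    then have x: "x \<le> 1 / 243" by (simp add: x_def field_simps)
    have "gl_density 5 * (485 / 486) \<le> gl_density 5 * (485 / 486 + 1 / (2 * 3 ^ r))"
      using gl_density_pos[of 5] by (intro mult_left_mono) auto
    also have "\<dots> \<le> gl_density r" by (rule gl_density_lower[OF 4])
    finally have g: "8053760 / 14348907 * (485 / 486) \<le> gl_density r" by (simp add: num)
    have k: "242 / 243 * (80 / 243) \<le> (1 - x) * (1 / 3 - x)"
      using x by (intro mult_mono) auto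
    have "5715 / 10000 \<le> 8053760 / 14348907 * (485 / 486) * (1 + 242 / 243 * (80 / 243) / 16 :: real)"
      by simp
    also have "\<dots> \<le> gl_density r * (1 + (1 - x) * (1 / 3 - x) / 16)"
      using g k gl_density_pos[of r] by (intro mult_mono) auto
    finally show ?thesis by (simp add: x_def)
  qed (simp_all add: num)
qed

lemma good_fraction:
  fixes V :: "'a::exponent3 set" and S :: "'i set"
  assumes V: "subsp V" "finite V" "card V = 3 ^ r" and S: "finite S" "card S = r"
  shows "5715 / 10000 * real (card (S \<rightarrow>\<^sub>E V \<times> V)) \<le> real (card {u \<in> S \<rightarrow>\<^sub>E V \<times> V. good V u S})"
proof -
  define \<U> where "\<U> = {U. subsp U \<and> U \<subseteq> V \<and> 9 * card U = card V}"
  define M where "M = ((3::real) ^ r) ^ r"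
  have M0: "0 \<le> M" by (simp add: M_def)
  have total: "real (card (S \<rightarrow>\<^sub>E V \<times> V)) = M * M"
    using S V by (simp add: card_PiE card_cartesian_product M_def power_mult_distrib)
  have "real (gl_card r * (card V ^ r + (\<Sum>U\<in>\<U>. card U ^ r)))
      \<le> real (card {u \<in> S \<rightarrow>\<^sub>E V \<times> V. good V u S})"
    unfolding \<U>_def of_nat_le_iff by (rule card_good_ge[OF V S])
  then have lower: "M * gl_density r * (M + (\<Sum>U\<in>\<U>. real (card U) ^ r))
      \<le> real (card {u \<in> S \<rightarrow>\<^sub>E V \<times> V. good V u S})"
    by (simp add: gl_card_eq V(3) M_def)
  have "5715 / 10000 * (M * M) \<le> M * gl_density r * (M + (\<Sum>U\<in>\<U>. real (card U) ^ r))"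
  proof (cases "2 \<le> r")
    case True
    define \<kappa> :: real where "\<kappa> = (1 - 1 / 3 ^ r) * (1 / 3 - 1 / 3 ^ r) / 16"
    from True obtain m where m: "r = m + 2" by (metis add.commute le_Suc_ex)
    have \<U>: "\<U> = {U. subsp U \<and> U \<subseteq> V \<and> card U = 3 ^ m}"
      unfolding \<U>_def V(3) m by auto
    have "(\<Sum>U\<in>\<U>. real (card U) ^ r) = (\<Sum>U\<in>\<U>. (3 ^ m) ^ r)"
      by (rule sum.cong) (auto simp: \<U>)
    also have "\<dots> = real (card \<U>) * (3 ^ m) ^ r" by simp
    also have "(3 ^ m) ^ r = M / 9 ^ r"
    proof -
      have "(3 ^ m) ^ r * 9 ^ r = ((3 ^ m * 9 :: real)) ^ r" by (simp only: power_mult_distrib)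
      also have "3 ^ m * 9 = (3 :: real) ^ r" by (simp add: m)
      finally show ?thesis by (simp add: M_def field_simps)
    qed
    also have "real (card \<U>) = (3 ^ r - 1) * (3 ^ r / 3 - 1) / 16"
      using card_codim2[OF V(1,2), of m] V(3) unfolding \<U> m by simp
    also have "(3 ^ r - 1) * (3 ^ r / 3 - 1) / 16 * (M / 9 ^ r)
        = M * ((1 - 1 / 3 ^ r) * (1 / 3 - 1 / 3 ^ r) / 16)"
    proof -
      have "(9::real) ^ r = 3 ^ r * 3 ^ r" by (simp add: power_mult_distrib[symmetric])
      then show ?thesis by (simp add: field_simps)
    qed
    finally have sum: "(\<Sum>U\<in>\<U>. real (card U) ^ r) = M * \<kappa>" unfolding \<kappa>_def .
    have "M * gl_density r * (M + (\<Sum>U\<in>\<U>. real (card U) ^ r)) = M * M * (gl_density r * (1 + \<kappa>))"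
      unfolding sum by (simp add: algebra_simps)
    moreover have "M * M * (5715 / 10000) \<le> M * M * (gl_density r * (1 + \<kappa>))"
      using good_density_lower[OF True] M0 unfolding \<kappa>_def by (intro mult_left_mono) auto
    ultimately show ?thesis by linarith
  next
    case False
    then have "r = 0 \<or> r = 1" by auto
    then have "5715 / 10000 \<le> gl_density r" by (auto simp: gl_density_def)
    then have "M * M * (5715 / 10000) \<le> M * M * gl_density r" using M0 by (intro mult_left_mono) auto
    also have "\<dots> = M * gl_density r * M" by simp
    also have "\<dots> \<le> M * gl_density r * (M + (\<Sum>U\<in>\<U>. real (card U) ^ r))"
      using M0 gl_density_pos[of r] by (intro mult_left_mono) (auto intro: sum_nonneg)
    finally show ?thesis by simp
  qed
  with lower show ?thesis unfolding total by linarith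
qed

section \<open>The hitting set\<close>

lemma card_PiE_restrict:
  assumes "finite A" "S \<subseteq> A"
  shows "card {u \<in> A \<rightarrow>\<^sub>E T. Q (restrict u S)} = card {v \<in> S \<rightarrow>\<^sub>E T. Q v} * card ((A - S) \<rightarrow>\<^sub>E T)"
proof -
  have "bij_betw (\<lambda>u. (restrict u S, restrict u (A - S))) {u \<in> A \<rightarrow>\<^sub>E T. Q (restrict u S)}
      ({v \<in> S \<rightarrow>\<^sub>E T. Q v} \<times> ((A - S) \<rightarrow>\<^sub>E T))"
  proof (rule bij_betwI[where g = "\<lambda>(v, w) i. if i \<in> S then v i else w i"])
    show "(\<lambda>u. (restrict u S, restrict u (A - S))) \<in> {u \<in> A \<rightarrow>\<^sub>E T. Q (restrict u S)} \<rightarrow>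
        {v \<in> S \<rightarrow>\<^sub>E T. Q v} \<times> ((A - S) \<rightarrow>\<^sub>E T)"
      using assms(2) by (auto simp: restrict_PiE_iff)
    have res: "restrict (\<lambda>i. if i \<in> S then v i else w i) S = v" if "v \<in> S \<rightarrow>\<^sub>E T" for v w
      using that by (auto simp: fun_eq_iff PiE_iff extensional_def)
    show "(\<lambda>(v, w) i. if i \<in> S then v i else w i) \<in>
        {v \<in> S \<rightarrow>\<^sub>E T. Q v} \<times> ((A - S) \<rightarrow>\<^sub>E T) \<rightarrow> {u \<in> A \<rightarrow>\<^sub>E T. Q (restrict u S)}"
      using assms(2) by (auto simp: res)
  next
    fix u assume "u \<in> {u \<in> A \<rightarrow>\<^sub>E T. Q (restrict u S)}"
    then show "(\<lambda>(v, w) i. if i \<in> S then v i else w i) (restrict u S, restrict u (A - S)) = u"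
      by (auto simp: fun_eq_iff PiE_iff extensional_def)
  next
    fix y assume "y \<in> {v \<in> S \<rightarrow>\<^sub>E T. Q v} \<times> ((A - S) \<rightarrow>\<^sub>E T)"
    then show "(\<lambda>u. (restrict u S, restrict u (A - S))) ((\<lambda>(v, w) i. if i \<in> S then v i else w i) y) = y"
      by (auto simp: fun_eq_iff PiE_iff extensional_def)
  qed
  then show ?thesis by (simp add: bij_betw_same_card card_cartesian_product)
qed

lemma exists_good_labelling:
  fixes V :: "'a::exponent3 set" and A :: "'i set"
  assumes V: "subsp V" "finite V" "card V = 3 ^ r" and A: "finite A"
  obtains u where "5715 / 10000 * real (card A choose r) \<le> real (card {S. S \<subseteq> A \<and> card S = r \<and> good V u S})"
proof -
  define \<Omega> where "\<Omega> = A \<rightarrow>\<^sub>E V \<times> V"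
  define \<S> where "\<S> = {S. S \<subseteq> A \<and> card S = r}"
  have fin\<Omega>: "finite \<Omega>" unfolding \<Omega>_def using A V by (intro finite_PiE) auto
  have "(\<lambda>i\<in>A. (0, 0)) \<in> \<Omega>" using subsp_0[OF V(1)] by (auto simp: \<Omega>_def)
  then have \<Omega>0: "\<Omega> \<noteq> {}" by blast
  have fin\<S>: "finite \<S>" unfolding \<S>_def by (rule finite_subset[of _ "Pow A"]) (use A in auto)
  have card\<S>: "card \<S> = card A choose r" unfolding \<S>_def by (rule n_subsets[OF A])
  have S: "5715 / 10000 * real (card \<Omega>) \<le> real (card {u \<in> \<Omega>. good V u S})" if "S \<in> \<S>" for S
  proof -
    have SA: "S \<subseteq> A" "card S = r" "finite S" using that A finite_subset by (auto simp: \<S>_def)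
    have good: "good V (restrict u S) S \<longleftrightarrow> good V u S" for u by (simp add: good_def)
    have 1: "card {u \<in> \<Omega>. good V u S}
        = card {u \<in> S \<rightarrow>\<^sub>E V \<times> V. good V u S} * card ((A - S) \<rightarrow>\<^sub>E V \<times> V)"
      using card_PiE_restrict[OF A SA(1), of "V \<times> V" "\<lambda>u. good V u S"] by (simp add: good \<Omega>_def)
    have 2: "card \<Omega> = card (S \<rightarrow>\<^sub>E V \<times> V) * card ((A - S) \<rightarrow>\<^sub>E V \<times> V)"
      using card_PiE_restrict[OF A SA(1), of "V \<times> V" "\<lambda>_. True"] by (simp add: \<Omega>_def)
    show ?thesis
      using mult_right_mono[OF good_fraction[OF V SA(3,2)], of "real (card ((A - S) \<rightarrow>\<^sub>E V \<times> V))"]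
      unfolding 1 2 by (simp add: mult.assoc)
  qed
  have sum: "(\<Sum>u\<in>\<Omega>. real (card {S \<in> \<S>. good V u S})) = (\<Sum>S\<in>\<S>. real (card {u \<in> \<Omega>. good V u S}))"
  proof -
    have "(\<Sum>u\<in>\<Omega>. real (card {S \<in> \<S>. good V u S})) = (\<Sum>u\<in>\<Omega>. \<Sum>S\<in>\<S>. of_bool (good V u S))"
      using fin\<S> by (simp add: Collect_conj_eq)
    also have "\<dots> = (\<Sum>S\<in>\<S>. \<Sum>u\<in>\<Omega>. of_bool (good V u S))" by (rule sum.swap)
    also have "\<dots> = (\<Sum>S\<in>\<S>. real (card {u \<in> \<Omega>. good V u S}))"
      using fin\<Omega> by (simp add: Collect_conj_eq)
    finally show ?thesis .
  qed
  have "\<exists>u\<in>\<Omega>. 5715 / 10000 * real (card A choose r) \<le> real (card {S \<in> \<S>. good V u S})"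
  proof (rule ccontr)
    assume "\<not> ?thesis"
    then have "(\<Sum>u\<in>\<Omega>. real (card {S \<in> \<S>. good V u S})) < (\<Sum>u\<in>\<Omega>. 5715 / 10000 * real (card A choose r))"
      using fin\<Omega> \<Omega>0 by (intro sum_strict_mono) auto
    also have "\<dots> = (\<Sum>S\<in>\<S>. 5715 / 10000 * real (card \<Omega>))" by (simp add: card\<S>)
    also have "\<dots> \<le> (\<Sum>S\<in>\<S>. real (card {u \<in> \<Omega>. good V u S}))" by (intro sum_mono S)
    finally show False using sum by simp
  qed
  then show ?thesis using that by (auto simp: \<S>_def conj_assoc)
qed

definition coord_space :: "nat \<Rightarrow> (nat \<Rightarrow> trit) set" where
  "coord_space r = {f. \<forall>i\<ge>r. f i = 0}"

lemma subsp_coord_space: "subsp (coord_space r)"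
  by (auto simp: subsp_def coord_space_def)

lemma bij_betw_coord_space:
  "bij_betw (\<lambda>f i. if i < r then f i else 0) ({..<r} \<rightarrow>\<^sub>E (UNIV :: trit set)) (coord_space r)"
  by (rule bij_betwI[where g = "\<lambda>f. restrict f {..<r}"])
    (auto simp: coord_space_def fun_eq_iff PiE_iff extensional_def)

lemma finite_coord_space: "finite (coord_space r)"
  using bij_betw_finite[OF bij_betw_coord_space, of r] by (simp add: finite_PiE UNIV_trit)

lemma card_coord_space: "card (coord_space r) = 3 ^ r"
  using bij_betw_same_card[OF bij_betw_coord_space, of r] by (simp add: card_PiE UNIV_trit numeral_3_eq_3)

definition supp :: "nat \<Rightarrow> (nat \<Rightarrow> nat) \<Rightarrow> nat set" where
  "supp n x = {i \<in> {1..n}. x i = 1}"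

lemma inj_on_supp: "inj_on (supp n) (cube n)"
proof (rule inj_onI)
  fix x y assume xy: "x \<in> cube n" "y \<in> cube n" "supp n x = supp n y"
  show "x = y"
  proof
    fix i
    show "x i = y i"
    proof (cases "i \<in> {1..n}")
      case True
      then have "x i = 1 \<longleftrightarrow> y i = 1" using xy(3) by (auto simp: supp_def set_eq_iff)
      moreover have "x i \<in> {0, 1}" "y i \<in> {0, 1}" using xy(1,2) True by (auto simp: cube_def PiE_iff)
      ultimately show ?thesis by auto
    next
      case False
      then show ?thesis using xy(1,2) by (auto simp: cube_def PiE_iff extensional_def)
    qed
  qed
qed

lemma shift_to_residue:
  fixes a k :: nat
  assumes "a < 3"
  obtains s where "s \<in> {2, 3, 4}" "(k + s) mod 3 = a"
proof -
  have "(k + (2 + (a + 2 * k + 1) mod 3)) mod 3 = (k + 2 + (a + 2 * k + 1)) mod 3"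
    using mod_add_right_eq[of "k + 2" "a + 2 * k + 1" 3] by (simp only: add.assoc)
  also have "k + 2 + (a + 2 * k + 1) = 3 * (k + 1) + a" by simp
  also have "\<dots> mod 3 = a" using assms by (simp only: mod_mult_self4 mod_less)
  finally have "(k + (2 + (a + 2 * k + 1) mod 3)) mod 3 = a" .
  moreover have "(a + 2 * k + 1) mod 3 < 3" by simp
  then have "2 + (a + 2 * k + 1) mod 3 \<in> {2, 3, 4}" by auto
  ultimately show ?thesis using that by blast
qed

lemma hitting_number_6_le: "real (hitting_number n 6) \<le> 4285 / 30000 * 2 ^ n"
proof -
  have "\<forall>r. \<exists>u. 5715 / 10000 * real (n choose r)
      \<le> real (card {S. S \<subseteq> {1..n} \<and> card S = r \<and> good (coord_space r) u S})"
  proof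
    fix r
    obtain u where "5715 / 10000 * real (card {1..n} choose r)
        \<le> real (card {S. S \<subseteq> {1..n} \<and> card S = r \<and> good (coord_space r) u S})"
      by (rule exists_good_labelling[OF subsp_coord_space finite_coord_space card_coord_space
            finite_atLeastAtMost])
    then show "\<exists>u. 5715 / 10000 * real (n choose r)
        \<le> real (card {S. S \<subseteq> {1..n} \<and> card S = r \<and> good (coord_space r) u S})"
      by (intro exI[of _ u]) simp
  qed
  from choice[OF this] obtain u where "\<forall>r. 5715 / 10000 * real (n choose r)
      \<le> real (card {S. S \<subseteq> {1..n} \<and> card S = r \<and> good (coord_space r) (u r) S})" ..
  then have u: "5715 / 10000 * real (n choose r)
      \<le> real (card {S. S \<subseteq> {1..n} \<and> card S = r \<and> good (coord_space r) (u r) S})" for r ..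
  define G where "G S \<longleftrightarrow> good (coord_space (card S)) (u (card S)) S" for S
  define bad where "bad = {S. S \<subseteq> {1..n} \<and> \<not> G S}"
  have finbad: "finite {S. S \<subseteq> {1..n} \<and> P S}" for P
    by (rule finite_subset[of _ "Pow {1..n}"]) auto
  have bad_layer: "real (card {S \<in> bad. card S = r}) \<le> 4285 / 10000 * real (n choose r)" for r
  proof -
    have "n choose r = card {S. S \<subseteq> {1..n} \<and> card S = r}" using n_subsets[of "{1..n}" r] by simp
    also have "{S. S \<subseteq> {1..n} \<and> card S = r} = {S \<in> bad. card S = r} \<union>
        {S. S \<subseteq> {1..n} \<and> card S = r \<and> good (coord_space r) (u r) S}"
      by (auto simp: bad_def G_def)
    also have "card \<dots> = card {S \<in> bad. card S = r} +
        card {S. S \<subseteq> {1..n} \<and> card S = r \<and> good (coord_space r) (u r) S}"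
      using finbad by (intro card_Un_disjoint) (auto simp: bad_def G_def)
    finally show ?thesis using u[of r] by simp
  qed
  have "real (card bad) = (\<Sum>r\<le>n. real (card {S \<in> bad. card S = r}))"
  proof -
    have "bad = (\<Union>r\<in>{..n}. {S \<in> bad. card S = r})"
      using card_mono[of "{1..n}"] by (fastforce simp: bad_def)
    then have "card bad = card (\<Union>r\<in>{..n}. {S \<in> bad. card S = r})" by simp
    also have "\<dots> = (\<Sum>r\<le>n. card {S \<in> bad. card S = r})"
      using finbad by (intro card_UN_disjoint) (auto simp: bad_def)
    finally show ?thesis by simp
  qed
  also have "\<dots> \<le> (\<Sum>r\<le>n. 4285 / 10000 * real (n choose r))" by (intro sum_mono bad_layer)
  also have "\<dots> = 4285 / 10000 * real (\<Sum>r\<le>n. n choose r)" by (simp add: sum_distrib_left)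
  also have "(\<Sum>r\<le>n. n choose r) = 2 ^ n" by (rule choose_row_sum)
  finally have card_bad: "real (card bad) \<le> 4285 / 10000 * 2 ^ n" by simp
  define B where "B a = {S \<in> bad. card S mod 3 = a}" for a
  have "k mod 3 = 0 \<or> k mod 3 = 1 \<or> k mod 3 = 2" for k :: nat by presburger
  then have "bad = B 0 \<union> (B 1 \<union> B 2)" unfolding B_def by blast
  moreover have "finite (B a)" for a unfolding B_def bad_def using finbad by simp
  then have "card (B 0 \<union> (B 1 \<union> B 2)) = card (B 0) + (card (B 1) + card (B 2))"
    by (simp add: card_Un_disjoint B_def disjoint_iff)
  ultimately have "card bad = card (B 0) + (card (B 1) + card (B 2))" by simp
  then have "3 * card (B 0) \<le> card bad \<or> 3 * card (B 1) \<le> card bad \<or> 3 * card (B 2) \<le> card bad"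
    by linarith
  then obtain a where "a \<in> {0, 1, 2}" and "3 * card (B a) \<le> card bad" by blast
  then have a: "a < 3" "3 * card (B a) \<le> card bad" by auto
  define H where "H = {x \<in> cube n. supp n x \<in> B a}"
  have "hitting_number n 6 \<le> card H"
  proof (rule hitting_number_lower)
    show "H \<subseteq> cube n" by (auto simp: H_def)
    show "\<forall>C\<in>subcubes n 6. H \<inter> C \<noteq> {}"
    proof (intro ballI notI)
      fix C assume Cin: "C \<in> subcubes n 6" and HC: "H \<inter> C = {}"
      obtain I b where C: "C = {x \<in> cube n. \<forall>i\<in>{1..n} - I. x i = b i}"
        and I: "I \<subseteq> {1..n}" "card I = 6" and b: "b \<in> {1..n} - I \<rightarrow> {0, 1}"
        using Cin unfolding subcubes_def by blast
      define R where "R = {i \<in> {1..n} - I. b i = 1}"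
      obtain s where s: "s \<in> {2, 3, 4}" "(card R + s) mod 3 = a"
        by (rule shift_to_residue[OF a(1)])
      show False
      proof (rule not_all_good[OF subsp_coord_space finite_coord_space card_coord_space _ refl I(2) s(1)])
        show "finite R" by (simp add: R_def)
        fix Y assume Y: "Y \<subseteq> I" "card Y = s"
        define x where "x = (\<lambda>i. if i \<in> {1..n} then if i \<in> I then if i \<in> Y then 1 else 0 else b i else undefined)"
        have "x \<in> cube n" using b by (auto simp: x_def cube_def PiE_iff extensional_def Pi_iff)
        then have "x \<in> C" by (auto simp: C x_def)
        with \<open>x \<in> cube n\<close> HC have "supp n x \<notin> B a" unfolding H_def by blast
        moreover have "supp n x = R \<union> Y" using Y I by (auto simp: supp_def x_def R_def)
        moreover have card: "card (R \<union> Y) = card R + s"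
          using Y I finite_subset[of Y "{1..n}"] by (subst card_Un_disjoint) (auto simp: R_def)
        moreover have "R \<union> Y \<subseteq> {1..n}" using Y I by (auto simp: R_def)
        ultimately have "G (R \<union> Y)" using s(2) by (simp add: B_def bad_def)
        then show "good (coord_space (card R + s)) (u (card R + s)) (R \<union> Y)"
          by (simp add: G_def card)
      qed
    qed
  qed
  also have "card H \<le> card (B a)"
    using inj_on_supp[of n] finbad
    by (intro card_inj_on_le[of "supp n"]) (auto simp: H_def B_def bad_def inj_on_def)
  finally have "3 * real (hitting_number n 6) \<le> real (card bad)" using a(2) by linarith
  with card_bad show ?thesis by simp
qed

theorem theorem6:
  "vertex_turan_density 6 > 6 / 7 \<and> hitting_density 6 < 1 / 7"
proof -
  have "hitting_density 6 \<le> 4285 / 30000"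
    using hitting_number_6_le
    by (intro LIMSEQ_le_const2[OF hitting_density_tendsto]) (auto simp: field_simps)
  then show ?thesis using hitting_density_eq[of 6] by simp
qed

end
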